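(* Let $(\widehat\theta,\widehat\eta)$ and $(\widehat\theta^{*},\widehat\eta^{*})$ be the semiparametric M-estimator and its exchangeably weighted bootstrap version, as defined in the context. Suppose that the bootstrap weights satisfy Conditions W1--W5 of the context, with constant $c>0$ as in W5, and that the following hold. (M1) There is a constant $K>0$ such that for all $(\theta,\eta)\in\Theta\times\mathcal H$, $$E_X\big(m(\theta,\eta)-m(\theta_0,\eta_0)\big)\le -K\big(\|\theta-\theta_0\|^2+d^2(\eta,\eta_0)\big).$$ (M2) For $\delta>0$ let $\mathcal N_\delta=\{m(\theta,\eta)-m(\theta_0,\eta_0): \|\theta-\theta_0\|\le\delta,\ d(\eta,\eta_0)\le\delta,\ (\theta,\eta)\in\Theta\times\mathcal H\}$. For some $p'>2$ there is a universal constant $C$ such that for every $\delta>0$ (and every $n$), $$\big(E_X\|\mathbb G_n\|_{\mathcal N_\delta}^{p'}\big)^{1/p'}\le C\delta,\qquad \big(E_{XW}\|\mathbb G_n^{*}\|_{\mathcal N_\delta}^{p'}\big)^{1/p'}\le C\delta .$$ (M3) $d(\widehat\eta,\eta_0)=O_{P_X}(n^{-1/2})$ and $d(\widehat\eta^{*},\eta_0)=O_{P_{XW}}(n^{-1/2})$. Suppose moreover that, for an invertible covariance matrix $\Sigma$, $\sqrt n(\widehat\theta-\theta_0)$ converges in distribution to $N(0,\Sigma)$ and, conditionally on $\mathcal X_n=(X_1,\dots,X_n)$, $(\sqrt n/c)(\widehat\theta^{*}-\widehat\theta)$ converges weakly to $N(0,\Sigma)$ in $P_X$-probability. Let $\widehat\Sigma$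 be a consistent estimator of $\Sigma$ based on $(X_1,\dots,X_n)$, i.e. $\widehat\Sigma\to\Sigma$ in $P_X$-probability. Then, with $\widehat\Sigma^{*}$ the bootstrap variance estimate and $BC_t(\alpha)$ the $t$-type bootstrap confidence set defined in the context, as $n\to\infty$, $$\widehat\Sigma^{*}\longrightarrow\Sigma\ \text{ in } P_X\text{-probability},\qquad P_{XW}\big(\theta_0\in BC_t(\alpha)\big)\longrightarrow 1-\alpha .$$
   Context: Setting. $X_1,X_2,\dots$ are i.i.d. with law $P_X$; $\Theta\subset\mathbb R^d$ is the space of the Euclidean parameter $\theta$, and $\mathcal H$ is an infinite-dimensional parameter space (nuisance parameter $\eta$) with distance $d(\cdot,\cdot)$. For each $(\theta,\eta)\in\Theta\times\mathcal H$, $m(\theta,\eta)$ is a real-valued function of an observation $x$ (the objective function). Put $(\theta_0,\eta_0)=\arg\sup_{\theta\in\Theta,\eta\in\mathcal H}E_X m(\theta,\eta)(X)$. For each $n$, $W_n=(W_{n1},\dots,W_{nn})'$ is a random vector of bootstrap weights with law $P_W$, independent of the data. $E_{W|\mathcal X_n}$, $P_{W|\mathcal X_n}$ denote conditional expectation and probability given $\mathcal X_n=(X_1,\dots,X_n)$; $E_{XW}$, $P_{XW}$ denote joint expectation and probability. Write $P_Xf=\int f\,dP_X$, $\mathbb P_nf=n^{-1}\sum_{i=1}^n f(X_i)$, $\mathbb P_n^{*}f=n^{-1}\sum_{i=1}^n W_{ni}f(X_i)$, $\mathbb G_nf=\sqrt n(\mathbb P_n-P_X)f$, $\mathbb G_n^{*}f=\sqrt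 n(\mathbb P_n^{*}-\mathbb P_n)f$, and $\|\mathbb G_n\|_{\mathcal F}=\sup_{f\in\mathcal F}|\mathbb G_nf|$, $\|\mathbb G_n^{*}\|_{\mathcal F}=\sup_{f\in\mathcal F}|\mathbb G_n^{*}f|$ for a class of functions $\mathcal F$. Estimators: $(\widehat\theta,\widehat\eta)=\arg\sup_{\theta\in\Theta,\eta\in\mathcal H}\mathbb P_n m(\theta,\eta)$ and $(\widehat\theta^{*},\widehat\eta^{*})=\arg\sup_{\theta\in\Theta,\eta\in\mathcal H}\mathbb P_n^{*}m(\theta,\eta)$. Weight conditions, where $\|Y\|_{2,1}=\int_0^\infty\sqrt{P_W(|Y|\ge u)}\,du$: W1. $W_n$ is exchangeable for every $n$. W2. $W_{ni}\ge0$ for all $n,i$ and $\sum_{i=1}^nW_{ni}=n$ for all $n$. W3. $\limsup_{n\to\infty}\|W_{n1}\|_{2,1}<\infty$. W4. $\lim_{\lambda\to\infty}\limsup_{n\to\infty}\sup_{t\ge\lambda}t^2P_W(W_{n1}>t)=0$. W5. $n^{-1}\sum_{i=1}^n(W_{ni}-1)^2\to c^2$ in $P_W$-probability, for a constant $c^2>0$. Conditional weak convergence: for a random vector $T_n^{*}$ that is a function of $(X_1,\dots,X_n)$ and $(W_{n1},\dots,W_{nn})$, the conditional distribution of $T_n^{*}$ given $\mathcal X_n$ converges weakly to a fixed distribution $\mu$ in $P_X$-probability if $\sup_{f\in BL_1}|E_{W|\mathcal X_n}f(T_n^{*})-\int f\,d\mu|\to0$ in $P_X$-probability, where $BL_1$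 is the class of functions bounded by 1 in absolute value with Lipschitz constant at most 1. Bootstrap variance estimate: $\widehat\Sigma^{*}=(n/c^2)E_{W|\mathcal X_n}(\widehat\theta^{*}-\widehat\theta)(\widehat\theta^{*}-\widehat\theta)'$. $t$-type bootstrap confidence set: for $\alpha\in(0,1)$, $$BC_t(\alpha)=\left[\widehat\theta-\frac{\widehat\Sigma^{1/2}\omega^{*}_{n(1-\alpha/2)}}{\sqrt n},\ \widehat\theta-\frac{\widehat\Sigma^{1/2}\omega^{*}_{n(\alpha/2)}}{\sqrt n}\right],$$ where, for $\beta\in(0,1)$, $\omega^{*}_{n\beta}$ satisfies $P_{W|\mathcal X_n}\big((\sqrt n/c)(\widehat\Sigma^{*})^{-1/2}(\widehat\theta^{*}-\widehat\theta)\le\omega^{*}_{n\beta}\big)=\beta$. Inequalities between vectors (and hence the interval) are understood componentwise; $\omega^{*}_{n\beta}$ is not unique when $\theta$ is a vector.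
   Formalization: The coverage claim is stated only for a one-dimensional θ: with componentwise inequalities and joint vector quantiles it fails for d ≥ 2 (e.g. bivariate normal mean with Bayesian bootstrap). The consistency of the bootstrap variance estimate is stated for every d. *)

theory Defs
  imports "HOL-Probability.Probability"
begin

section \<open>Outer expectation and stochastic order\<close>

text \<open>
  Suprema over uncountable classes of functions need not be measurable, and the library's
  \<open>nn_integral\<close> of a non-measurable function is a lower integral.  As usual in empirical process
  theory, expectations of such suprema are outer expectations; for measurable functions this is
  the ordinary expectation.  In the same way probabilities of possibly non-measurable events are
  taken with the library's \<open>outer_measure_of\<close>.
\<close>

definition outer_expectation :: "'a measure \<Rightarrow> ('a \<Rightarrow> ennreal) \<Rightarrow> ennreal" where
  "outer_expectation M f =
     (INF g\<in>{g \<in> borel_measurable M. \<forall>x\<in>space M. f x \<le> g x}. \<integral>\<^sup>+x. g x \<partial>M)"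

definition ennreal_rpow :: "ennreal \<Rightarrow> real \<Rightarrow> ennreal" where
  "ennreal_rpow a p = (if a = top then top else ennreal (enn2real a powr p))"

definition outer_Lp_norm :: "'a measure \<Rightarrow> real \<Rightarrow> ('a \<Rightarrow> ennreal) \<Rightarrow> ennreal" where
  "outer_Lp_norm M p f =
     ennreal_rpow (outer_expectation M (\<lambda>x. ennreal_rpow (f x) p)) (1 / p)"

definition conv_in_prob ::
  "'a measure \<Rightarrow> (nat \<Rightarrow> 'a \<Rightarrow> 'b::metric_space) \<Rightarrow> 'b \<Rightarrow> bool" where
  "conv_in_prob M Y l \<longleftrightarrow>
     (\<forall>\<epsilon>>0. (\<lambda>n. outer_measure_of M {x\<in>space M. \<epsilon> < dist (Y n x) l}) \<longlonglongrightarrow> 0)"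

definition bigO_in_prob ::
  "'a measure \<Rightarrow> (nat \<Rightarrow> 'a \<Rightarrow> real) \<Rightarrow> (nat \<Rightarrow> real) \<Rightarrow> bool" where
  "bigO_in_prob M Y r \<longleftrightarrow>
     (\<forall>\<epsilon>>0. \<exists>B. \<forall>\<^sub>F n in sequentially.
        outer_measure_of M {x\<in>space M. B * r n < \<bar>Y n x\<bar>} \<le> ennreal \<epsilon>)"

definition conv_in_distr ::
  "'a measure \<Rightarrow> (nat \<Rightarrow> 'a \<Rightarrow> 'b::metric_space) \<Rightarrow> 'b measure \<Rightarrow> bool" where
  "conv_in_distr M Y \<mu> \<longleftrightarrow>
     (\<forall>f :: 'b \<Rightarrow> real. continuous_on UNIV f \<and> bounded (range f) \<longrightarrow>
        (\<lambda>n. \<integral>x. f (Y n x) \<partial>M) \<longlonglongrightarrow> (\<integral>y. f y \<partial>\<mu>))"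


section \<open>Matrices and the centred normal law\<close>

definition psd_matrix :: "real^'d^'d \<Rightarrow> bool" where
  "psd_matrix A \<longleftrightarrow> transpose A = A \<and> (\<forall>v. 0 \<le> v \<bullet> (A *v v))"

text \<open>The unique positive semidefinite square root; unspecified if \<open>A\<close> is not positive semidefinite.\<close>

definition matrix_sqrt :: "real^'d^'d \<Rightarrow> real^'d^'d" where
  "matrix_sqrt A = (THE R. psd_matrix R \<and> R ** R = A)"

definition outer_prod :: "real^'d \<Rightarrow> real^'d^'d" where
  "outer_prod v = (\<chi> i j. v $ i * v $ j)"

definition mv_normal :: "real^'d^'d \<Rightarrow> (real^'d) measure" where
  "mv_normal \<Sigma> = density lborel
     (\<lambda>z. ennreal (exp (- (z \<bullet> (matrix_inv \<Sigma> *v z)) / 2) / sqrt ((2 * pi) ^ CARD('d) * det \<Sigma>)))"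


section \<open>Empirical and bootstrap empirical processes\<close>

text \<open>
  Sequences are indexed from 0: a sample of size \<open>n\<close> is \<open>xs 0, ..., xs (n - 1)\<close>, and the weight
  written \<open>W_n1\<close> on paper is \<open>W n 0\<close>.
\<close>

definition emp :: "nat \<Rightarrow> (nat \<Rightarrow> 'x) \<Rightarrow> ('x \<Rightarrow> real) \<Rightarrow> real" where
  "emp n xs f = (\<Sum>i<n. f (xs i)) / real n"

definition boot_emp :: "nat \<Rightarrow> (nat \<Rightarrow> 'x) \<Rightarrow> (nat \<Rightarrow> real) \<Rightarrow> ('x \<Rightarrow> real) \<Rightarrow> real" where
  "boot_emp n xs ws f = (\<Sum>i<n. ws i * f (xs i)) / real n"

definition emp_process :: "'x measure \<Rightarrow> nat \<Rightarrow> (nat \<Rightarrow> 'x) \<Rightarrow> ('x \<Rightarrow> real) \<Rightarrow> real" where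
  "emp_process P n xs f = sqrt (real n) * (emp n xs f - (\<integral>x. f x \<partial>P))"

definition boot_process ::
  "nat \<Rightarrow> (nat \<Rightarrow> 'x) \<Rightarrow> (nat \<Rightarrow> real) \<Rightarrow> ('x \<Rightarrow> real) \<Rightarrow> real" where
  "boot_process n xs ws f = sqrt (real n) * (boot_emp n xs ws f - emp n xs f)"

definition sup_over :: "(('x \<Rightarrow> real) \<Rightarrow> real) \<Rightarrow> ('x \<Rightarrow> real) set \<Rightarrow> ennreal" where
  "sup_over G F = (SUP f\<in>F. ennreal \<bar>G f\<bar>)"

definition increment_class ::
  "('t::real_normed_vector \<Rightarrow> 'h \<Rightarrow> 'x \<Rightarrow> real) \<Rightarrow> 't set \<Rightarrow> 'h set \<Rightarrow> ('h \<Rightarrow> 'h \<Rightarrow> real) \<Rightarrow>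
     't \<Rightarrow> 'h \<Rightarrow> real \<Rightarrow> ('x \<Rightarrow> real) set" where
  "increment_class m \<Theta> H d \<theta>0 \<eta>0 \<delta> =
     {\<lambda>x. m \<theta> \<eta> x - m \<theta>0 \<eta>0 x | \<theta> \<eta>.
        \<theta> \<in> \<Theta> \<and> \<eta> \<in> H \<and> norm (\<theta> - \<theta>0) \<le> \<delta> \<and> d \<eta> \<eta>0 \<le> \<delta>}"

definition is_argsup ::
  "(('x \<Rightarrow> real) \<Rightarrow> real) \<Rightarrow> ('t \<Rightarrow> 'h \<Rightarrow> 'x \<Rightarrow> real) \<Rightarrow> 't set \<Rightarrow> 'h set \<Rightarrow> 't \<Rightarrow> 'h \<Rightarrow> bool" where
  "is_argsup E m \<Theta> H \<theta> \<eta> \<longleftrightarrow>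
     is_arg_max (\<lambda>(t, h). E (m t h)) (\<lambda>q. q \<in> \<Theta> \<times> H) (\<theta>, \<eta>)"


section \<open>Data and weights\<close>

text \<open>
  Data live on \<open>MX\<close>, weights on \<open>MW\<close>, and joint statements are about the product measure; so
  weights and data are independent, and the conditional expectation given the data of a function of
  data and weights is the integral over \<open>MW\<close> with the data held fixed.
\<close>

definition iid_data :: "'a measure \<Rightarrow> 'x measure \<Rightarrow> (nat \<Rightarrow> 'a \<Rightarrow> 'x) \<Rightarrow> bool" where
  "iid_data MX P X \<longleftrightarrow>
     prob_space.indep_vars MX (\<lambda>_. P) X UNIV \<and> (\<forall>i. distr MX P (X i) = P)"

definition obs :: "(nat \<Rightarrow> 'a \<Rightarrow> 'x) \<Rightarrow> nat \<Rightarrow> 'a \<Rightarrow> (nat \<Rightarrow> 'x)" where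
  "obs X n x = (\<lambda>i\<in>{..<n}. X i x)"

definition wvec :: "(nat \<Rightarrow> nat \<Rightarrow> 'w \<Rightarrow> real) \<Rightarrow> nat \<Rightarrow> 'w \<Rightarrow> (nat \<Rightarrow> real)" where
  "wvec W n w = (\<lambda>i\<in>{..<n}. W n i w)"

definition norm21 :: "'w measure \<Rightarrow> ('w \<Rightarrow> real) \<Rightarrow> ennreal" where
  "norm21 M Y = (\<integral>\<^sup>+u\<in>{0..}. ennreal (sqrt (measure M {w\<in>space M. u \<le> \<bar>Y w\<bar>})) \<partial>lborel)"

definition weights_W1 :: "'w measure \<Rightarrow> (nat \<Rightarrow> nat \<Rightarrow> 'w \<Rightarrow> real) \<Rightarrow> bool" where
  "weights_W1 MW W \<longleftrightarrow>
     (\<forall>n \<pi>. \<pi> permutes {..<n} \<longrightarrow>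
        distr MW (\<Pi>\<^sub>M i\<in>{..<n}. borel) (\<lambda>w. \<lambda>i\<in>{..<n}. W n (\<pi> i) w) =
        distr MW (\<Pi>\<^sub>M i\<in>{..<n}. borel) (\<lambda>w. \<lambda>i\<in>{..<n}. W n i w))"

definition weights_W2 :: "'w measure \<Rightarrow> (nat \<Rightarrow> nat \<Rightarrow> 'w \<Rightarrow> real) \<Rightarrow> bool" where
  "weights_W2 MW W \<longleftrightarrow>
     (\<forall>n. AE w in MW. (\<forall>i<n. 0 \<le> W n i w) \<and> (\<Sum>i<n. W n i w) = real n)"

definition weights_W3 :: "'w measure \<Rightarrow> (nat \<Rightarrow> nat \<Rightarrow> 'w \<Rightarrow> real) \<Rightarrow> bool" where
  "weights_W3 MW W \<longleftrightarrow> limsup (\<lambda>n. norm21 MW (W n 0)) < top"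

definition weights_W4 :: "'w measure \<Rightarrow> (nat \<Rightarrow> nat \<Rightarrow> 'w \<Rightarrow> real) \<Rightarrow> bool" where
  "weights_W4 MW W \<longleftrightarrow>
     ((\<lambda>l::real. limsup (\<lambda>n. SUP t\<in>{l..}. ennreal (t\<^sup>2 * measure MW {w\<in>space MW. t < W n 0 w})))
        \<longlongrightarrow> 0) at_top"

definition weights_W5 :: "'w measure \<Rightarrow> (nat \<Rightarrow> nat \<Rightarrow> 'w \<Rightarrow> real) \<Rightarrow> real \<Rightarrow> bool" where
  "weights_W5 MW W c \<longleftrightarrow>
     conv_in_prob MW (\<lambda>n w. (\<Sum>i<n. (W n i w - 1)\<^sup>2) / real n) (c\<^sup>2)"


section \<open>Conditional weak convergence and the bootstrap variance and confidence set\<close>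

definition BL1 :: "('b::metric_space \<Rightarrow> real) set" where
  "BL1 = {f. (\<forall>y. \<bar>f y\<bar> \<le> 1) \<and> 1-lipschitz_on UNIV f}"

definition cond_conv_in_distr ::
  "'a measure \<Rightarrow> 'w measure \<Rightarrow> (nat \<Rightarrow> 'a \<Rightarrow> 'w \<Rightarrow> 'b::metric_space) \<Rightarrow> 'b measure \<Rightarrow> bool" where
  "cond_conv_in_distr MX MW T \<mu> \<longleftrightarrow>
     conv_in_prob MX (\<lambda>n x. SUP f\<in>BL1. \<bar>(\<integral>w. f (T n x w) \<partial>MW) - (\<integral>y. f y \<partial>\<mu>)\<bar>) 0"

text \<open>
  Estimators are functions of the sample size, the sample and (for the bootstrap) the weights;
  \<open>th\<close> and \<open>thb\<close> stand for the estimator of the Euclidean parameter and its bootstrap version.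
\<close>

definition boot_variance ::
  "'w measure \<Rightarrow> (nat \<Rightarrow> nat \<Rightarrow> 'w \<Rightarrow> real) \<Rightarrow> real \<Rightarrow>
     (nat \<Rightarrow> (nat \<Rightarrow> 'x) \<Rightarrow> real^'d) \<Rightarrow> (nat \<Rightarrow> (nat \<Rightarrow> 'x) \<Rightarrow> (nat \<Rightarrow> real) \<Rightarrow> real^'d) \<Rightarrow>
     nat \<Rightarrow> (nat \<Rightarrow> 'x) \<Rightarrow> real^'d^'d" where
  "boot_variance MW W c th thb n xs =
     (real n / c\<^sup>2) *\<^sub>R (\<integral>w. outer_prod (thb n xs (wvec W n w) - th n xs) \<partial>MW)"

definition boot_t_stat ::
  "'w measure \<Rightarrow> (nat \<Rightarrow> nat \<Rightarrow> 'w \<Rightarrow> real) \<Rightarrow> real \<Rightarrow>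
     (nat \<Rightarrow> (nat \<Rightarrow> 'x) \<Rightarrow> real^'d) \<Rightarrow> (nat \<Rightarrow> (nat \<Rightarrow> 'x) \<Rightarrow> (nat \<Rightarrow> real) \<Rightarrow> real^'d) \<Rightarrow>
     nat \<Rightarrow> (nat \<Rightarrow> 'x) \<Rightarrow> (nat \<Rightarrow> real) \<Rightarrow> real^'d" where
  "boot_t_stat MW W c th thb n xs ws =
     (sqrt (real n) / c) *\<^sub>R
       (matrix_inv (matrix_sqrt (boot_variance MW W c th thb n xs)) *v (thb n xs ws - th n xs))"

text \<open>
  \<open>q n xs\<close> is a (vector) bootstrap quantile of level \<open>\<beta>\<close>; \<open>\<le>\<close> on vectors is componentwise.  The defining
  equation is required with probability tending to one: it cannot hold on samples for which the
  bootstrap variance is singular (for instance always when \<open>n = 1\<close> and the maximizer is unique).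
\<close>

definition boot_quantile ::
  "'a measure \<Rightarrow> (nat \<Rightarrow> 'a \<Rightarrow> 'x) \<Rightarrow> 'w measure \<Rightarrow> (nat \<Rightarrow> nat \<Rightarrow> 'w \<Rightarrow> real) \<Rightarrow> real \<Rightarrow>
     (nat \<Rightarrow> (nat \<Rightarrow> 'x) \<Rightarrow> real^'d) \<Rightarrow> (nat \<Rightarrow> (nat \<Rightarrow> 'x) \<Rightarrow> (nat \<Rightarrow> real) \<Rightarrow> real^'d) \<Rightarrow>
     real \<Rightarrow> (nat \<Rightarrow> (nat \<Rightarrow> 'x) \<Rightarrow> real^'d) \<Rightarrow> bool" where
  "boot_quantile MX X MW W c th thb \<beta> q \<longleftrightarrow>
     (\<lambda>n. outer_measure_of MX {x\<in>space MX.
        measure MW {w\<in>space MW.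
          boot_t_stat MW W c th thb n (obs X n x) (wvec W n w) \<le> q n (obs X n x)} \<noteq> \<beta>}) \<longlonglongrightarrow> 0"

text \<open>Here \<open>lo\<close> and \<open>up\<close> are the quantiles of levels \<open>\<alpha>/2\<close> and \<open>1 - \<alpha>/2\<close>; the interval is a componentwise box.\<close>

definition BC_t ::
  "(nat \<Rightarrow> (nat \<Rightarrow> 'x) \<Rightarrow> real^'d) \<Rightarrow> (nat \<Rightarrow> (nat \<Rightarrow> 'x) \<Rightarrow> real^'d^'d) \<Rightarrow>
     (nat \<Rightarrow> (nat \<Rightarrow> 'x) \<Rightarrow> real^'d) \<Rightarrow> (nat \<Rightarrow> (nat \<Rightarrow> 'x) \<Rightarrow> real^'d) \<Rightarrow>
     nat \<Rightarrow> (nat \<Rightarrow> 'x) \<Rightarrow> (real^'d) set" where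
  "BC_t th Sh lo up n xs =
     {th n xs - (1 / sqrt (real n)) *\<^sub>R (matrix_sqrt (Sh n xs) *v up n xs) ..
      th n xs - (1 / sqrt (real n)) *\<^sub>R (matrix_sqrt (Sh n xs) *v lo n xs)}"

end

(* Since the estimators maximise, the (bootstrap) empirical process of the increment dominates
   sqrt n K R^2, where R is the distance of the estimator from (theta0, eta0).  Peeling over dyadic
   shells and the moment bound M2 turn this into P(sqrt n R > t) <= B t^(-p) with p > 2, uniformly
   in n.  Hence |sqrt n (thb - th)|^2 is uniformly integrable, and conditional weak convergence to
   N(0, Sigma) upgrades to convergence of conditional second moments, which is the consistency of
   the bootstrap variance.  In dimension one, the bootstrap quantiles scaled by the square root of
   the bootstrap variance then converge in probability to the N(0, Sigma) quantiles, and the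
   coverage follows from the weak convergence of sqrt n (th - theta0). *)

theory Submission
  imports Defs "HOL-Real_Asymp.Real_Asymp"
begin

section \<open>Outer measure and convergence in probability\<close>

text \<open>The suprema in M2 and the nuisance distance need not be measurable, so peeling is done
  with outer measures, of which only monotonicity and countable subadditivity survive; ordinary
  measure returns only for the events about \<open>th\<close> and \<open>thb\<close>, which are
  measurable. M2 controls the processes at deterministic radii while the distance R is random, and
  the shells replace R by a deterministic \<delta> at the cost of a factor 2. The moment order p > 2
  matters because a tail t^(-p) then has a square-integrable remainder that vanishes uniformly in n.
  This remainder is small only on average over the data, not sample by sample, so Markov's
  inequality over the data has to come before the conditional weak convergence is used. The normal
  law is given by a density formula alone: that its total mass is 1 is read off from the assumed
  weak convergence, tested with a constant, and positivity of the density is deduced from that mass.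
  Studentising only makes sense where the scalar variances are positive, so each quantile identity
  is stated off an event of vanishing outer measure.\<close>

lemma outer_measure_of_Un_le:
  "outer_measure_of M (A \<union> B) \<le> outer_measure_of M A + outer_measure_of M B"
proof (cases "A \<subseteq> space M \<and> B \<subseteq> space M")
  case True
  then obtain E F where "E \<in> sets M" "A \<subseteq> E" "outer_measure_of M A = emeasure M E"
    and "F \<in> sets M" "B \<subseteq> F" "outer_measure_of M B = emeasure M F"
    using outer_measure_of_attain[of A M] outer_measure_of_attain[of B M] by auto
  then show ?thesis
    using outer_measure_of_mono[of "A \<union> B" "E \<union> F" M] emeasure_subadditive[of E M F]
    by (auto intro: order_trans)
next
  case False
  \<comment> \<open>A set sticking out of \<open>space M\<close> has no measurable cover, so the
    infimum is over the empty family and equals \<open>top\<close>; this keeps the inequality free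
    of side conditions.\<close>
  have "outer_measure_of M C = top" if "\<not> C \<subseteq> space M" for C
  proof -
    have eq: "{B \<in> sets M. C \<subseteq> B} = {}" using that sets.sets_into_space by fastforce
    show ?thesis unfolding outer_measure_of_def eq by simp
  qed
  then have "outer_measure_of M A = top \<or> outer_measure_of M B = top" using False by blast
  then show ?thesis by (elim disjE) simp_all
qed

lemma outer_measure_of_UN_le:
  fixes A :: "nat \<Rightarrow> 'a set"
  assumes "\<And>i. A i \<subseteq> space M"
  shows "outer_measure_of M (\<Union>i. A i) \<le> (\<Sum>i. outer_measure_of M (A i))"
proof -
  obtain E where E: "\<And>i. E i \<in> sets M" "\<And>i. A i \<subseteq> E i" "\<And>i. outer_measure_of M (A i) = emeasure M (E i)"
    using outer_measure_of_attain[OF assms] by metis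
  have "outer_measure_of M (\<Union>i. A i) \<le> outer_measure_of M (\<Union>i. E i)"
    using E by (intro outer_measure_of_mono) auto
  also have "\<dots> = emeasure M (\<Union>i. E i)" using E by auto
  also have "\<dots> \<le> (\<Sum>i. emeasure M (E i))" using E by (intro emeasure_subadditive_countably) auto
  finally show ?thesis using E by simp
qed

lemma outer_measure_of_mono_AE:
  assumes "AE x in M. x \<in> A \<longrightarrow> x \<in> B" "A \<subseteq> space M"
  shows "outer_measure_of M A \<le> outer_measure_of M B"
proof -
  obtain N where N: "{x\<in>space M. \<not> (x \<in> A \<longrightarrow> x \<in> B)} \<subseteq> N" "N \<in> sets M" "emeasure M N = 0"
    using assms(1) by (rule AE_E)
  have "outer_measure_of M A \<le> outer_measure_of M (B \<union> N)"
    using N(1) assms(2) by (intro outer_measure_of_mono) auto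
  also have "\<dots> \<le> outer_measure_of M B + outer_measure_of M N" by (rule outer_measure_of_Un_le)
  finally show ?thesis using N by simp
qed

text \<open>A measurable hull of \<open>A\<close> times \<open>space MW\<close> covers the cylinder,
  and \<open>MW\<close> has mass 1. This lifts tail bounds for the data process to the joint
  space.\<close>

lemma outer_measure_of_pair_fst:
  assumes "prob_space MW" "A \<subseteq> space MX"
  shows "outer_measure_of (MX \<Otimes>\<^sub>M MW) (A \<times> space MW) \<le> outer_measure_of MX A"
proof -
  interpret W: prob_space MW by fact
  obtain E where E: "E \<in> sets MX" "A \<subseteq> E" "outer_measure_of MX A = emeasure MX E"
    using outer_measure_of_attain[OF assms(2)] by auto
  have "outer_measure_of (MX \<Otimes>\<^sub>M MW) (A \<times> space MW) \<le> outer_measure_of (MX \<Otimes>\<^sub>M MW) (E \<times> space MW)"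
    using E by (intro outer_measure_of_mono) auto
  also have "\<dots> = emeasure MX E" using E by (simp add: W.emeasure_pair_measure_Times W.emeasure_space_1)
  finally show ?thesis using E by simp
qed

text \<open>Markov's inequality is applied to each measurable majorant of the p-th power, and only
  then is the infimum over majorants taken; the event itself may be non-measurable.\<close>

lemma outer_Lp_norm_Markov:
  assumes "outer_Lp_norm M p f \<le> ennreal K" "0 < p" "0 < s" "0 \<le> K"
  shows "outer_measure_of M {x\<in>space M. ennreal s \<le> f x} \<le> ennreal ((K / s) powr p)"
proof -
  let ?h = "\<lambda>x. ennreal_rpow (f x) p"
  define e where "e = outer_expectation M ?h"
  have e_le: "e \<le> ennreal (K powr p)"
  proof -
    have le: "ennreal_rpow e (1 / p) \<le> ennreal K"
      using assms(1) by (simp add: outer_Lp_norm_def e_def)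
    \<comment> \<open>\<open>ennreal_rpow\<close> keeps \<open>top\<close>, so a finite bound
      excludes \<open>e = top\<close>, where \<open>enn2real\<close> would silently return
      0.\<close>
    then have "e \<noteq> top" by (auto simp: ennreal_rpow_def top_unique)
    with le have "enn2real e powr (1 / p) \<le> K"
      using \<open>0 \<le> K\<close> by (simp add: ennreal_rpow_def)
    then have "(enn2real e powr (1 / p)) powr p \<le> K powr p"
      using \<open>0 < p\<close> by (intro powr_mono2) auto
    then have "enn2real e \<le> K powr p" using \<open>0 < p\<close> by (simp add: powr_powr)
    then show ?thesis using \<open>e \<noteq> top\<close>
      by (metis ennreal_enn2real ennreal_leI less_top)
  qed
  let ?o = "outer_measure_of M {x\<in>space M. ennreal s \<le> f x}"
  have "ennreal (s powr p) * ?o \<le> e"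
    unfolding e_def outer_expectation_def
  proof (rule INF_greatest)
    fix g assume "g \<in> {g \<in> borel_measurable M. \<forall>x\<in>space M. ?h x \<le> g x}"
    then have g[measurable]: "g \<in> borel_measurable M" and hg: "\<And>x. x \<in> space M \<Longrightarrow> ?h x \<le> g x" by auto
    have "ennreal (s powr p) \<le> g x" if "x \<in> space M" "ennreal s \<le> f x" for x
    proof -
      have "ennreal (s powr p) \<le> ?h x"
      proof (cases "f x = top")
        case False
        then have "s \<le> enn2real (f x)"
          using that(2) by (metis ennreal_enn2real ennreal_le_iff enn2real_nonneg less_top)
        then show ?thesis using False \<open>0 < s\<close> \<open>0 < p\<close>
          by (auto simp: ennreal_rpow_def intro!: ennreal_leI powr_mono2)
      qed (simp add: ennreal_rpow_def)
      then show ?thesis using hg[OF that(1)] by (rule order_trans)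
    qed
    then have "?o \<le> outer_measure_of M {x\<in>space M. ennreal (s powr p) \<le> g x}"
      by (intro outer_measure_of_mono) auto
    also have "\<dots> = emeasure M {x\<in>space M. ennreal (s powr p) \<le> g x}" by (intro outer_measure_of_eq) auto
    finally have "ennreal (s powr p) * ?o \<le> (\<integral>\<^sup>+x. ennreal (s powr p) * indicator {x\<in>space M. ennreal (s powr p) \<le> g x} x \<partial>M)"
      by (simp add: nn_integral_cmult_indicator mult_left_mono)
    also have "\<dots> \<le> (\<integral>\<^sup>+x. g x \<partial>M)"
      by (intro nn_integral_mono) (auto split: split_indicator)
    finally show "ennreal (s powr p) * ?o \<le> (\<integral>\<^sup>+x. g x \<partial>M)" .
  qed
  then have *: "ennreal (s powr p) * ?o \<le> ennreal (K powr p)" using e_le by (rule order_trans)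
  have "?o = ennreal (1 / s powr p) * (ennreal (s powr p) * ?o)"
    using \<open>0 < s\<close> by (simp add: mult.assoc[symmetric] ennreal_mult[symmetric])
  also have "\<dots> \<le> ennreal (1 / s powr p) * ennreal (K powr p)"
    by (intro mult_left_mono *) simp
  also have "\<dots> = ennreal ((K / s) powr p)"
    using assms by (simp add: ennreal_mult[symmetric] powr_divide)
  finally show ?thesis .
qed

lemma outer_measure_null_Un:
  assumes "(\<lambda>n. outer_measure_of M (A n)) \<longlonglongrightarrow> 0" "(\<lambda>n. outer_measure_of M (B n)) \<longlonglongrightarrow> 0"
    and "\<forall>\<^sub>F n in sequentially. C n \<subseteq> A n \<union> B n"
  shows "(\<lambda>n. outer_measure_of M (C n)) \<longlonglongrightarrow> 0"
proof (rule tendsto_sandwich[of "\<lambda>_. 0"])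
  show "\<forall>\<^sub>F n in sequentially. outer_measure_of M (C n) \<le> outer_measure_of M (A n) + outer_measure_of M (B n)"
    using assms(3) by eventually_elim (meson order_trans outer_measure_of_mono outer_measure_of_Un_le)
  show "(\<lambda>n. outer_measure_of M (A n) + outer_measure_of M (B n)) \<longlonglongrightarrow> 0"
    using tendsto_add[OF assms(1,2)] by simp
qed auto

lemma outer_measure_null_subset:
  assumes "(\<lambda>n. outer_measure_of M (A n)) \<longlonglongrightarrow> 0" "\<forall>\<^sub>F n in sequentially. C n \<subseteq> A n"
  shows "(\<lambda>n. outer_measure_of M (C n)) \<longlonglongrightarrow> 0"
  using outer_measure_null_Un[OF assms(1,1)] assms(2) by simp

lemma outer_measure_null_UN_finite:
  assumes "finite I" "\<And>i. i \<in> I \<Longrightarrow> (\<lambda>n. outer_measure_of M (A i n)) \<longlonglongrightarrow> 0"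
  shows "(\<lambda>n. outer_measure_of M (\<Union>i\<in>I. A i n)) \<longlonglongrightarrow> 0"
  using assms
proof (induction I)
  case (insert i I)
  show ?case
  proof (rule outer_measure_null_Un)
    show "(\<lambda>n. outer_measure_of M (A i n)) \<longlonglongrightarrow> 0" using insert.prems by simp
    show "(\<lambda>n. outer_measure_of M (\<Union>i\<in>I. A i n)) \<longlonglongrightarrow> 0" using insert by simp
  qed simp
qed simp

lemma conv_in_probD:
  "conv_in_prob M Y l \<Longrightarrow> 0 < e \<Longrightarrow> (\<lambda>n. outer_measure_of M {x\<in>space M. e < dist (Y n x) l}) \<longlonglongrightarrow> 0"
  by (auto simp: conv_in_prob_def)

lemma conv_in_prob_cong:
  assumes "conv_in_prob M Y l" "(\<lambda>n. outer_measure_of M {x\<in>space M. Y n x \<noteq> Z n x}) \<longlonglongrightarrow> 0"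
  shows "conv_in_prob M Z l"
  unfolding conv_in_prob_def
proof (intro allI impI)
  fix e :: real assume "0 < e"
  show "(\<lambda>n. outer_measure_of M {x\<in>space M. e < dist (Z n x) l}) \<longlonglongrightarrow> 0"
    by (rule outer_measure_null_Un[OF conv_in_probD[OF assms(1) \<open>0 < e\<close>] assms(2)]) (auto intro!: always_eventually)
qed

text \<open>Continuous mapping for a constant limit: continuity at the single point \<open>l\<close>
  is enough, which later admits square roots and quotients near a positive limit.\<close>

lemma conv_in_prob_isCont:
  assumes "conv_in_prob M Y l" "isCont g l"
  shows "conv_in_prob M (\<lambda>n x. g (Y n x)) (g l)"
  unfolding conv_in_prob_def
proof (intro allI impI)
  fix e :: real assume "0 < e"
  then obtain r where r: "0 < r" "\<And>y. dist y l < r \<Longrightarrow> dist (g y) (g l) < e"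
    using assms(2) unfolding continuous_at_eps_delta by blast
  have "0 < r / 2" using r by simp
  show "(\<lambda>n. outer_measure_of M {x\<in>space M. e < dist (g (Y n x)) (g l)}) \<longlonglongrightarrow> 0"
  proof (rule outer_measure_null_subset[OF conv_in_probD[OF assms(1) \<open>0 < r / 2\<close>]], intro always_eventually allI subsetI)
    fix n x assume x: "x \<in> {x \<in> space M. e < dist (g (Y n x)) (g l)}"
    then have "\<not> dist (Y n x) l < r" using r(2) by force
    then show "x \<in> {x \<in> space M. r / 2 < dist (Y n x) l}" using x r(1) by auto
  qed
qed

lemma conv_in_prob_Pair:
  assumes "conv_in_prob M Y l" "conv_in_prob M Z k"
  shows "conv_in_prob M (\<lambda>n x. (Y n x, Z n x)) (l, k)"
  unfolding conv_in_prob_def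
proof (intro allI impI)
  fix e :: real assume "0 < e"
  then have "0 < e / 2" by simp
  show "(\<lambda>n. outer_measure_of M {x\<in>space M. e < dist (Y n x, Z n x) (l, k)}) \<longlonglongrightarrow> 0"
  proof (rule outer_measure_null_Un[OF conv_in_probD[OF assms(1) \<open>0 < e / 2\<close>] conv_in_probD[OF assms(2) \<open>0 < e / 2\<close>]],
      intro always_eventually allI subsetI)
    fix n x assume x: "x \<in> {x \<in> space M. e < dist (Y n x, Z n x) (l, k)}"
    have "dist (Y n x, Z n x) (l, k) \<le> dist (Y n x) l + dist (Z n x) k"
      by (simp add: dist_Pair_Pair sqrt_sum_squares_le_sum)
    then show "x \<in> {x \<in> space M. e / 2 < dist (Y n x) l} \<union> {x \<in> space M. e / 2 < dist (Z n x) k}"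
      using x by auto
  qed
qed

lemma conv_in_prob_vec:
  fixes Y :: "nat \<Rightarrow> 'a \<Rightarrow> ('b::real_normed_vector)^'n"
  assumes "\<And>i. conv_in_prob M (\<lambda>n x. Y n x $ i) (l $ i)"
  shows "conv_in_prob M Y l"
  unfolding conv_in_prob_def
proof (intro allI impI)
  fix e :: real assume "0 < e"
  define r where "r = e / (CARD('n) + 1)"
  have "0 < r" using \<open>0 < e\<close> by (simp add: r_def)
  have "(\<lambda>n. outer_measure_of M (\<Union>i\<in>UNIV. {x\<in>space M. r < dist (Y n x $ i) (l $ i)})) \<longlonglongrightarrow> 0"
    by (intro outer_measure_null_UN_finite conv_in_probD[OF assms] \<open>0 < r\<close>) auto
  then show "(\<lambda>n. outer_measure_of M {x\<in>space M. e < dist (Y n x) l}) \<longlonglongrightarrow> 0"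
  proof (rule outer_measure_null_subset, intro always_eventually allI subsetI)
    fix n x assume x: "x \<in> {x \<in> space M. e < dist (Y n x) l}"
    show "x \<in> (\<Union>i\<in>UNIV. {x\<in>space M. r < dist (Y n x $ i) (l $ i)})"
    proof (rule ccontr)
      assume "\<not> ?thesis"
      then have *: "norm ((Y n x - l) $ i) \<le> r" for i using x by (auto simp: dist_norm not_less)
      have "norm (Y n x - l) \<le> (\<Sum>i\<in>UNIV. norm ((Y n x - l) $ i))"
        unfolding norm_vec_def by (intro L2_set_le_sum) auto
      also have "\<dots> \<le> real CARD('n) * r" using * by (intro sum_bounded_above) auto
      also have "\<dots> \<le> e" using \<open>0 < e\<close> by (simp add: r_def divide_simps)
      finally show False using x by (simp add: dist_norm)
    qed
  qed
qed

section \<open>Peeling and tail bounds\<close>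

text \<open>The index is one below the least k with \<open>R \<le> 2 ^ k * r\<close>, and
  \<open>r < R\<close> rules out k = 0. It supplies both the shells of \<open>peeling_tail\<close>
  and the layers of \<open>nn_integral_square_tail\<close>.\<close>

lemma dyadic_bracket:
  fixes r R :: real
  assumes "0 < r" "r < R"
  obtains j :: nat where "2 ^ j * r < R" "R \<le> 2 ^ Suc j * r"
proof -
  obtain k :: nat where "R / r < 2 ^ k" using real_arch_pow[of 2 "R / r"] by auto
  then have ex: "\<exists>k. R \<le> 2 ^ k * r" using \<open>0 < r\<close> by (auto simp: field_simps intro: less_imp_le)
  define k where "k = (LEAST k. R \<le> 2 ^ k * r)"
  have k: "R \<le> 2 ^ k * r" unfolding k_def by (rule LeastI_ex[OF ex])
  then obtain j where j: "k = Suc j" using assms by (cases k) auto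
  have "\<not> R \<le> 2 ^ j * r" using not_less_Least[of j "\<lambda>k. R \<le> 2 ^ k * r"] j by (auto simp: k_def)
  then show ?thesis using that[of j] k j by auto
qed

text \<open>On the j-th shell the quadratic lower bound is of order 4^j r^2, while the moment scale
  at radius 2^(j+1) r is only of order 2^j r; Markov then yields a factor 2^(-j p), which sums over
  j. Two processes \<open>S\<close> and \<open>T\<close> are carried because the bootstrap error
  splits into a sampling part and a resampling part.\<close>

lemma peeling_tail:
  fixes R :: "'a \<Rightarrow> real" and S T :: "real \<Rightarrow> 'a \<Rightarrow> ennreal"
  assumes "1 \<le> p" "0 < C" "0 < k" "0 < r"
    and dom: "AE x in M. \<forall>\<delta>>0. R x \<le> \<delta> \<longrightarrow> ennreal (k * (R x)\<^sup>2) \<le> S \<delta> x + T \<delta> x"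
    and S: "\<And>\<delta> s. 0 < \<delta> \<Longrightarrow> 0 < s \<Longrightarrow> outer_measure_of M {x\<in>space M. ennreal s \<le> S \<delta> x} \<le> ennreal ((C * \<delta> / s) powr p)"
    and T: "\<And>\<delta> s. 0 < \<delta> \<Longrightarrow> 0 < s \<Longrightarrow> outer_measure_of M {x\<in>space M. ennreal s \<le> T \<delta> x} \<le> ennreal ((C * \<delta> / s) powr p)"
  shows "outer_measure_of M {x\<in>space M. r < R x} \<le> ennreal (4 * (4 * C / (k * r)) powr p)"
proof -
  define A where "A j = {x\<in>space M. 2 ^ j * r < R x \<and> R x \<le> 2 ^ Suc j * r}" for j :: nat
  define q where "q = (4 * C / (k * r)) powr p"
  have "{x\<in>space M. r < R x} \<subseteq> (\<Union>j. A j)"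
    using \<open>0 < r\<close> by (auto simp: A_def elim!: dyadic_bracket)
  then have "outer_measure_of M {x\<in>space M. r < R x} \<le> outer_measure_of M (\<Union>j. A j)"
    by (rule outer_measure_of_mono)
  also have "\<dots> \<le> (\<Sum>j. outer_measure_of M (A j))"
    by (rule outer_measure_of_UN_le) (auto simp: A_def)
  also have "\<dots> \<le> (\<Sum>j. ennreal (2 * q * (1 / 2) ^ j))"
  proof (intro suminf_le)
    fix j :: nat
    define \<delta> where "\<delta> = 2 ^ Suc j * r"
    \<comment> \<open>Half of the lower bound for \<open>k * (R x)\<^sup>2\<close> on the shell: if
      the sum dominates 2 s, one of the two summands is at least s.\<close>
    define s where "s = k * (2 ^ j * r)\<^sup>2 / 2"
    have pos: "0 < \<delta>" "0 < s" using assms by (auto simp: \<delta>_def s_def)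
    have "C * \<delta> / s = 4 * C / (k * r) * (1 / 2) ^ j"
      using assms by (simp add: \<delta>_def s_def power2_eq_square field_simps power_divide)
    then have "(C * \<delta> / s) powr p = q * ((1 / 2) ^ j) powr p"
      using assms unfolding q_def by (simp only: powr_mult)
    \<comment> \<open>The hypothesis \<open>1 \<le> p\<close> turns the decay into a plain geometric
      series of ratio 1/2.\<close>
    also have "((1 / 2) ^ j) powr p \<le> ((1 / 2 :: real) ^ j) powr 1"
      using \<open>1 \<le> p\<close> by (intro powr_mono') (auto simp: power_le_one)
    finally have le: "(C * \<delta> / s) powr p \<le> q * (1 / 2) ^ j"
      by (simp add: q_def mult_left_mono)
    have "AE x in M. x \<in> A j \<longrightarrow> x \<in> {x\<in>space M. ennreal s \<le> S \<delta> x} \<union> {x\<in>space M. ennreal s \<le> T \<delta> x}"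
      using dom
    proof eventually_elim
      case (elim x)
      show ?case
      proof (intro impI, rule ccontr)
        assume x: "x \<in> A j" and "x \<notin> {x\<in>space M. ennreal s \<le> S \<delta> x} \<union> {x\<in>space M. ennreal s \<le> T \<delta> x}"
        then have "S \<delta> x < ennreal s" "T \<delta> x < ennreal s" by (auto simp: A_def)
        then have lt: "S \<delta> x + T \<delta> x < ennreal s + ennreal s" by (intro add_strict_mono)
        have "(2 ^ j * r)\<^sup>2 \<le> (R x)\<^sup>2" using x \<open>0 < r\<close> by (intro power_mono) (auto simp: A_def)
        then have "s + s \<le> k * (R x)\<^sup>2" using \<open>0 < k\<close> by (simp add: s_def)
        then have "ennreal s + ennreal s \<le> ennreal (k * (R x)\<^sup>2)"
          using pos by (simp add: ennreal_plus[symmetric] ennreal_leI del: ennreal_plus)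
        also have "\<dots> \<le> S \<delta> x + T \<delta> x" using elim x pos by (auto simp: A_def \<delta>_def)
        finally show False using lt by simp
      qed
    qed
    then have "outer_measure_of M (A j) \<le> outer_measure_of M ({x\<in>space M. ennreal s \<le> S \<delta> x} \<union> {x\<in>space M. ennreal s \<le> T \<delta> x})"
      by (rule outer_measure_of_mono_AE) (auto simp: A_def)
    also have "\<dots> \<le> outer_measure_of M {x\<in>space M. ennreal s \<le> S \<delta> x} + outer_measure_of M {x\<in>space M. ennreal s \<le> T \<delta> x}"
      by (rule outer_measure_of_Un_le)
    also have "\<dots> \<le> ennreal (q * (1 / 2) ^ j) + ennreal (q * (1 / 2) ^ j)"
      using S[OF pos] T[OF pos] le by (intro add_mono) (auto intro: order_trans ennreal_leI)
    also have "\<dots> = ennreal (2 * q * (1 / 2) ^ j)"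
      by (subst ennreal_plus[symmetric]) (auto simp: q_def)
    finally show "outer_measure_of M (A j) \<le> ennreal (2 * q * (1 / 2) ^ j)" .
  qed auto
  \<comment> \<open>The factor 4 is 2 for the two processes times 2 for the geometric sum.\<close>
  also have "\<dots> = ennreal (4 * q)"
  proof (intro suminf_ennreal_eq)
    show "(\<lambda>j. 2 * q * (1 / 2) ^ j) sums (4 * q)"
      using sums_mult[OF geometric_sums[of "1 / 2 :: real"], of "2 * q"] by simp
  qed (auto simp: q_def)
  finally show ?thesis by (simp add: q_def)
qed

text \<open>On the layer between \<open>2 ^ j * L\<close> and \<open>2 ^ Suc j * L\<close> the
  square is at most four times the squared lower end, whose probability decays like the power -p.
  The layers form a geometric series of ratio 2^(2 - p), convergent because p > 2, and the bound
  vanishes as L grows.\<close>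

lemma nn_integral_square_tail:
  fixes Y :: "'a \<Rightarrow> real"
  assumes [measurable]: "Y \<in> borel_measurable M"
    and tail: "\<And>t. 0 < t \<Longrightarrow> emeasure M {x\<in>space M. t < Y x} \<le> ennreal (B * t powr - p)"
    and "2 < p" "0 \<le> B" "0 < L"
  shows "(\<integral>\<^sup>+x. ennreal ((Y x)\<^sup>2) * indicator {x. L < Y x} x \<partial>M)
           \<le> ennreal (4 * B / (1 - 2 powr (2 - p)) * L powr (2 - p))"
proof -
  define q where "q = (2::real) powr (2 - p)"
  have q: "0 < q" "q < 1" using \<open>2 < p\<close> by (auto simp: q_def powr_less_one)
  have "(\<integral>\<^sup>+x. ennreal ((Y x)\<^sup>2) * indicator {x. L < Y x} x \<partial>M)
      \<le> (\<integral>\<^sup>+x. (\<Sum>j. ennreal ((2 ^ Suc j * L)\<^sup>2) * indicator {x\<in>space M. 2 ^ j * L < Y x} x) \<partial>M)"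
  proof (intro nn_integral_mono)
    fix x assume x: "x \<in> space M"
    show "ennreal ((Y x)\<^sup>2) * indicator {x. L < Y x} x
      \<le> (\<Sum>j. ennreal ((2 ^ Suc j * L)\<^sup>2) * indicator {x\<in>space M. 2 ^ j * L < Y x} x)"
    proof (cases "L < Y x")
      case True
      then obtain j where j: "2 ^ j * L < Y x" "Y x \<le> 2 ^ Suc j * L"
        using \<open>0 < L\<close> by (auto elim!: dyadic_bracket)
      have "ennreal ((Y x)\<^sup>2) * indicator {x. L < Y x} x \<le> ennreal ((2 ^ Suc j * L)\<^sup>2)"
        using True j \<open>0 < L\<close> by (auto intro!: ennreal_leI power_mono)
      also have "\<dots> = (\<Sum>i\<in>{j}. ennreal ((2 ^ Suc i * L)\<^sup>2) * indicator {x\<in>space M. 2 ^ i * L < Y x} x)"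
        using j x by simp
      also have "\<dots> \<le> (\<Sum>j. ennreal ((2 ^ Suc j * L)\<^sup>2) * indicator {x\<in>space M. 2 ^ j * L < Y x} x)"
        by (intro sum_le_suminf) auto
      finally show ?thesis .
    qed simp
  qed
  also have "\<dots> = (\<Sum>j. ennreal ((2 ^ Suc j * L)\<^sup>2) * emeasure M {x\<in>space M. 2 ^ j * L < Y x})"
    by (subst nn_integral_suminf) (auto simp: nn_integral_cmult_indicator)
  also have "\<dots> \<le> (\<Sum>j. ennreal (4 * B * L powr (2 - p) * q ^ j))"
  proof (intro suminf_le)
    fix j :: nat
    have pos: "0 < 2 ^ j * L" using \<open>0 < L\<close> by simp
    have "ennreal ((2 ^ Suc j * L)\<^sup>2) * emeasure M {x\<in>space M. 2 ^ j * L < Y x}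
        \<le> ennreal ((2 ^ Suc j * L)\<^sup>2) * ennreal (B * (2 ^ j * L) powr - p)"
      by (intro mult_left_mono tail pos) simp
    also have "\<dots> = ennreal ((2 ^ Suc j * L)\<^sup>2 * (B * (2 ^ j * L) powr - p))"
      using \<open>0 \<le> B\<close> by (simp add: ennreal_mult)
    also have "(2 ^ Suc j * L)\<^sup>2 * (B * (2 ^ j * L) powr - p) = 4 * B * ((2 ^ j * L) powr 2 * (2 ^ j * L) powr - p)"
      using pos by (simp add: powr_realpow[of _ 2, simplified] power2_eq_square)
    also have "(2 ^ j * L) powr 2 * (2 ^ j * L) powr - p = (2 ^ j * L) powr (2 - p)"
      by (simp add: powr_add[symmetric])
    also have "\<dots> = L powr (2 - p) * q ^ j"
      using \<open>0 < L\<close> by (simp add: powr_mult q_def powr_power powr_realpow[symmetric] powr_powr mult.commute)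
    finally show "ennreal ((2 ^ Suc j * L)\<^sup>2) * emeasure M {x\<in>space M. 2 ^ j * L < Y x}
        \<le> ennreal (4 * B * L powr (2 - p) * q ^ j)" by (simp add: mult.assoc)
  qed auto
  also have "\<dots> = ennreal (4 * B * L powr (2 - p) * (1 / (1 - q)))"
    using q \<open>0 \<le> B\<close> by (intro suminf_ennreal_eq sums_mult geometric_sums) auto
  finally show ?thesis by (simp add: q_def field_simps)
qed

section \<open>Moments of the normal law\<close>

definition mvn_dens :: "real^'d^'d \<Rightarrow> real^'d \<Rightarrow> real" where
  "mvn_dens \<Sigma> z = exp (- (z \<bullet> (matrix_inv \<Sigma> *v z)) / 2) / sqrt ((2 * pi) ^ CARD('d) * det \<Sigma>)"

lemma borel_measurable_matrix_vector_mult[measurable]: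
  fixes A :: "real^'n^'m"
  shows "(\<lambda>v. A *v v) \<in> borel_measurable borel"
  by (intro borel_measurable_continuous_onI continuous_intros matrix_vector_mult_linear_continuous_on)

lemma mvn_dens_measurable[measurable]: "mvn_dens \<Sigma> \<in> borel_measurable borel"
  unfolding mvn_dens_def by measurable

lemma mv_normal_eq: "mv_normal \<Sigma> = density lborel (\<lambda>z. ennreal (mvn_dens \<Sigma> z))"
  by (simp add: mv_normal_def mvn_dens_def)

lemma space_mv_normal[simp]: "space (mv_normal \<Sigma>) = UNIV"
  and sets_mv_normal[simp, measurable_cong]: "sets (mv_normal \<Sigma>) = sets borel"
  by (simp_all add: mv_normal_def)

text \<open>The mass becomes known only as a real number, through a Bochner integral of a constant.
  The value 1 excludes infinite mass, since \<open>enn2real\<close> maps \<open>top\<close> to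
  0.\<close>

lemma prob_space_mv_normal:
  assumes "measure (mv_normal \<Sigma>) UNIV = 1"
  shows "prob_space (mv_normal \<Sigma>)"
proof (rule prob_spaceI)
  have "emeasure (mv_normal \<Sigma>) UNIV = 1"
    using assms unfolding measure_def
    by (metis enn2real_positive_iff enn2real_top ennreal_1 ennreal_enn2real less_top zero_neq_one)
  then show "emeasure (mv_normal \<Sigma>) (space (mv_normal \<Sigma>)) = 1" by simp
qed

text \<open>The sign of the density is that of its normalising constant and does not depend on z. If
  that constant were not positive (real \<open>sqrt\<close> is odd and division by 0 gives 0), the
  density would be nonpositive everywhere and the mass would be 0. This replaces a proof that
  \<open>det \<Sigma>\<close> is positive.\<close>

lemma mvn_dens_pos:
  fixes \<Sigma> :: "real^'d^'d"
  assumes "prob_space (mv_normal \<Sigma>)"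
  shows "0 < mvn_dens \<Sigma> z"
proof (rule ccontr)
  assume "\<not> 0 < mvn_dens \<Sigma> z"
  then have "sqrt ((2 * pi) ^ CARD('d) * det \<Sigma>) \<le> 0"
    unfolding mvn_dens_def not_less divide_le_0_iff using exp_gt_zero less_le_not_le by blast
  then have "mvn_dens \<Sigma> z \<le> 0" for z by (simp add: mvn_dens_def divide_le_0_iff)
  then have "emeasure (mv_normal \<Sigma>) UNIV = 0"
    by (simp add: mv_normal_eq emeasure_density ennreal_neg)
  then show False using prob_space.emeasure_space_1[OF assms] by simp
qed

lemma nn_integral_lborel_translate:
  fixes f :: "'a::euclidean_space \<Rightarrow> ennreal"
  assumes [measurable]: "f \<in> borel_measurable borel"
  shows "(\<integral>\<^sup>+z. f (c + z) \<partial>lborel) = (\<integral>\<^sup>+z. f z \<partial>lborel)"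
proof -
  have "(\<integral>\<^sup>+z. f (c + z) \<partial>lborel) = (\<integral>\<^sup>+z. f z \<partial>distr lborel borel ((+) c))"
    by (subst nn_integral_distr) auto
  then show ?thesis by (simp add: lborel_distr_plus)
qed

lemma matrix_inv_works:
  fixes A :: "real^'n^'n"
  assumes "invertible A"
  shows "A ** matrix_inv A = mat 1" "matrix_inv A ** A = mat 1"
proof -
  have "A ** matrix_inv A = mat 1 \<and> matrix_inv A ** A = mat 1"
    unfolding matrix_inv_def by (rule someI_ex) (use assms in \<open>simp add: invertible_def\<close>)
  then show "A ** matrix_inv A = mat 1" "matrix_inv A ** A = mat 1" by auto
qed

lemma transpose_matrix_inv:
  fixes A :: "real^'n^'n"
  assumes "invertible A" "transpose A = A"
  shows "transpose (matrix_inv A) = matrix_inv A"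
proof -
  have "transpose (matrix_inv A) ** A = mat 1"
    using matrix_inv_works(1)[OF assms(1)] assms(2) by (metis matrix_transpose_mul transpose_mat)
  then have "transpose (matrix_inv A) ** (A ** matrix_inv A) = matrix_inv A"
    by (simp add: matrix_mul_assoc)
  then show ?thesis using matrix_inv_works(1)[OF assms(1)] by simp
qed

text \<open>Translating by \<open>\<Sigma> u\<close> multiplies the density by the exponential tilt with parameter \<open>u\<close>, so the
  moment generating function follows from the total mass being 1, without computing any Gaussian integral.\<close>

lemma mv_normal_mgf:
  fixes \<Sigma> :: "real^'d^'d"
  assumes "invertible \<Sigma>" "transpose \<Sigma> = \<Sigma>" "prob_space (mv_normal \<Sigma>)"
  shows "(\<integral>\<^sup>+z. ennreal (exp (u \<bullet> z)) \<partial>mv_normal \<Sigma>) = ennreal (exp (u \<bullet> (\<Sigma> *v u) / 2))"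
proof -
  interpret prob_space "mv_normal \<Sigma>" by fact
  let ?A = "matrix_inv \<Sigma>" and ?h = "\<Sigma> *v u"
  have Ah: "?A *v ?h = u"
    using matrix_inv_works(2)[OF assms(1)] by (simp add: matrix_vector_mul_assoc)
  have sym: "x \<bullet> (?A *v y) = (?A *v x) \<bullet> y" for x y
    using transpose_matrix_inv[OF assms(1,2)] by (metis dot_lmul_matrix vector_transpose_matrix)
  have nonneg: "0 \<le> mvn_dens \<Sigma> z" for z
    using mvn_dens_pos[OF assms(3)] by (rule less_imp_le)
  have quad: "(- ?h + z) \<bullet> (?A *v (- ?h + z)) = z \<bullet> (?A *v z) - 2 * (u \<bullet> z) + u \<bullet> (\<Sigma> *v u)" for z
  proof -
    have "?A *v (- ?h + z) = - u + ?A *v z"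
      by (simp add: matrix_vector_right_distrib matrix_vector_mult_diff_distrib Ah uminus_add_conv_diff del: add_uminus_conv_diff)
    then have "(- ?h + z) \<bullet> (?A *v (- ?h + z)) = ?h \<bullet> u - ?h \<bullet> (?A *v z) - z \<bullet> u + z \<bullet> (?A *v z)"
      by (simp add: inner_diff_left inner_diff_right)
    moreover have "?h \<bullet> (?A *v z) = u \<bullet> z" using sym[of ?h z] Ah by simp
    ultimately show ?thesis by (simp add: inner_commute)
  qed
  have shift: "mvn_dens \<Sigma> z * exp (u \<bullet> z) = exp (u \<bullet> (\<Sigma> *v u) / 2) * mvn_dens \<Sigma> (- ?h + z)" for z
  proof -
    have "exp (- Q / 2) * exp w = exp (v / 2) * exp (- (Q - 2 * w + v) / 2)" for Q w v :: real
      unfolding mult_exp_exp by (rule arg_cong[of _ _ exp]) (simp add: field_simps)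
    then show ?thesis unfolding mvn_dens_def quad by (simp add: times_divide_eq_left times_divide_eq_right)
  qed
  have "(\<integral>\<^sup>+z. ennreal (exp (u \<bullet> z)) \<partial>mv_normal \<Sigma>) = (\<integral>\<^sup>+z. ennreal (mvn_dens \<Sigma> z * exp (u \<bullet> z)) \<partial>lborel)"
    unfolding mv_normal_eq by (subst nn_integral_density) (auto simp: ennreal_mult nonneg)
  also have "\<dots> = (\<integral>\<^sup>+z. ennreal (exp (u \<bullet> (\<Sigma> *v u) / 2)) * ennreal (mvn_dens \<Sigma> (- ?h + z)) \<partial>lborel)"
    by (simp add: shift ennreal_mult nonneg)
  also have "\<dots> = ennreal (exp (u \<bullet> (\<Sigma> *v u) / 2)) * (\<integral>\<^sup>+z. ennreal (mvn_dens \<Sigma> (- ?h + z)) \<partial>lborel)"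
    by (rule nn_integral_cmult) simp
  also have "(\<integral>\<^sup>+z. ennreal (mvn_dens \<Sigma> (- ?h + z)) \<partial>lborel) = (\<integral>\<^sup>+z. ennreal (mvn_dens \<Sigma> z) \<partial>lborel)"
    by (rule nn_integral_lborel_translate) simp
  also have "\<dots> = 1"
    using emeasure_space_1 by (simp add: mv_normal_eq emeasure_density)
  finally show ?thesis by simp
qed

text \<open>The addition formula with \<open>cosh\<close> at least 1 makes \<open>sinh\<close>
  superadditive on nonnegative reals. With t = Y / (2 n) this dominates every difference quotient in
  \<open>second_moment_of_mgf\<close> by the one for n = 1.\<close>

lemma of_nat_mult_sinh_le:
  fixes t :: real
  assumes "0 \<le> t"
  shows "real n * sinh t \<le> sinh (real n * t)"
proof (induction n)
  case (Suc n)
  have "sinh (real (Suc n) * t) = sinh (real n * t) * cosh t + cosh (real n * t) * sinh t"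
    by (simp add: sinh_add distrib_right add.commute)
  also have "\<dots> \<ge> sinh (real n * t) * 1 + 1 * sinh t"
    using assms by (intro add_mono mult_left_mono mult_right_mono cosh_real_ge_1) auto
  finally show ?case using Suc by (simp add: algebra_simps)
qed simp

text \<open>Differentiates the moment generating function twice at 0 under the integral: central
  second differences with step 1/n converge to the square of Y pointwise and are dominated by the
  difference with n = 1, whose integrability is part of the hypothesis on the exponentials.\<close>

lemma second_moment_of_mgf:
  fixes Y :: "'a \<Rightarrow> real"
  assumes [measurable]: "Y \<in> borel_measurable M"
    and mgf: "\<And>s. has_bochner_integral M (\<lambda>x. exp (s * Y x)) (exp (s\<^sup>2 * v / 2))"
  shows "has_bochner_integral M (\<lambda>x. (Y x)\<^sup>2) v"
proof -
  \<comment> \<open>This is n^2 times the second central difference of s \<mapsto> exp (s Y) at 0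
    with step 1/n, written as a perfect square so that nonnegativity and monotone domination are
    visible.\<close>
  define g where "g n x = (real n * (2 * sinh (Y x / (2 * real n))))\<^sup>2" for n x
  have g_eq: "g n x = (real n)\<^sup>2 * (exp (1 / real n * Y x) + exp (- 1 / real n * Y x) - 2)" if "0 < n" for n x
  proof -
    define a b where "a = exp (Y x / (2 * real n))" and "b = exp (- (Y x / (2 * real n)))"
    have "a * a = exp (1 / real n * Y x)" "b * b = exp (- 1 / real n * Y x)" "a * b = 1"
      by (simp_all add: a_def b_def exp_add[symmetric])
    moreover have "2 * sinh (Y x / (2 * real n)) = a - b" by (simp add: sinh_field_def a_def b_def)
    moreover have "(real n * (a - b))\<^sup>2 = (real n)\<^sup>2 * (a * a + b * b - 2 * (a * b))"
      by (simp add: power2_eq_square algebra_simps)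
    ultimately show ?thesis unfolding g_def by simp
  qed
  \<comment> \<open>The hypothesis at s = 0 says that M has total mass 1; adding it to itself
    integrates the constant 2.\<close>
  have one: "has_bochner_integral M (\<lambda>x. 2 :: real) 2" using has_bochner_integral_add[OF mgf[of 0] mgf[of 0]] by simp
  have int_g: "has_bochner_integral M (g n) ((real n)\<^sup>2 * (2 * exp (v / (2 * (real n)\<^sup>2)) - 2))" if "0 < n" for n
  proof -
    have "has_bochner_integral M (\<lambda>x. (real n)\<^sup>2 * (exp (1 / real n * Y x) + exp (- 1 / real n * Y x) - 2))
        ((real n)\<^sup>2 * (exp ((1 / real n)\<^sup>2 * v / 2) + exp ((- 1 / real n)\<^sup>2 * v / 2) - 2))"
      by (intro has_bochner_integral_mult_right has_bochner_integral_diff has_bochner_integral_add mgf one)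
    moreover have "g n = (\<lambda>x. (real n)\<^sup>2 * (exp (1 / real n * Y x) + exp (- 1 / real n * Y x) - 2))"
      using g_eq[OF that] by auto
    ultimately show ?thesis by (simp add: power_divide mult.commute)
  qed
  have lim_g: "(\<lambda>n. g n x) \<longlonglongrightarrow> (Y x)\<^sup>2" for x
  proof -
    have "(\<lambda>n. real n * (2 * sinh (y / (2 * real n)))) \<longlonglongrightarrow> y" for y
    proof -
      consider "y = 0" | "y > 0" | "y < 0" by linarith
      then show ?thesis by cases (simp, real_asymp+)
    qed
    then show ?thesis unfolding g_def by (intro tendsto_intros)
  qed
  have g_le: "g n x \<le> g 1 x" if "0 < n" for n x
  proof -
    have "(real n * (2 * sinh (y / (2 * real n))))\<^sup>2 \<le> (2 * sinh (y / 2))\<^sup>2" if "0 \<le> y" for y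
    proof (rule power_mono)
      show "real n * (2 * sinh (y / (2 * real n))) \<le> 2 * sinh (y / 2)"
        using of_nat_mult_sinh_le[of "y / (2 * real n)" n] \<open>0 < n\<close> that by simp
    qed (use that in auto)
    from this[of "Y x"] this[of "- Y x"] show ?thesis
      by (cases "0 \<le> Y x") (auto simp: g_def)
  qed
  \<comment> \<open>The sequence is shifted to \<open>Suc n\<close> because the integral formula and
    the domination hold only for positive step counts.\<close>
  have *: "integrable M (\<lambda>x. (Y x)\<^sup>2) \<and> (\<lambda>n. \<integral>x. g (Suc n) x \<partial>M) \<longlonglongrightarrow> (\<integral>x. (Y x)\<^sup>2 \<partial>M)"
  proof
    have lim: "AE x in M. (\<lambda>n. g (Suc n) x) \<longlonglongrightarrow> (Y x)\<^sup>2"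
      using lim_g by (intro AE_I2 LIMSEQ_Suc)
    have bd: "AE x in M. norm (g (Suc n) x) \<le> g 1 x" for n
      using g_le[of "Suc n"] by (intro AE_I2) (simp add: g_def)
    have m: "g n \<in> borel_measurable M" for n unfolding g_def by (simp add: sinh_field_def)
    have i: "integrable M (g 1)" using int_g[of 1] by (auto simp: has_bochner_integral_iff)
    show "integrable M (\<lambda>x. (Y x)\<^sup>2)"
      by (rule integrable_dominated_convergence[OF _ m i lim bd]) simp
    show "(\<lambda>n. \<integral>x. g (Suc n) x \<partial>M) \<longlonglongrightarrow> (\<integral>x. (Y x)\<^sup>2 \<partial>M)"
      by (rule integral_dominated_convergence[OF _ m i lim bd]) simp
  qed
  have "(\<lambda>n. (real n)\<^sup>2 * (2 * exp (v / (2 * (real n)\<^sup>2)) - 2)) \<longlonglongrightarrow> v"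
  proof -
    consider "v = 0" | "v > 0" | "v < 0" by linarith
    then show ?thesis by cases (simp, real_asymp+)
  qed
  then have "(\<lambda>n. (real (Suc n))\<^sup>2 * (2 * exp (v / (2 * (real (Suc n))\<^sup>2)) - 2)) \<longlonglongrightarrow> v"
    by (rule LIMSEQ_Suc)
  then have "(\<lambda>n. \<integral>x. g (Suc n) x \<partial>M) \<longlonglongrightarrow> v"
    using int_g by (simp add: has_bochner_integral_iff)
  then show ?thesis using * LIMSEQ_unique by (auto simp: has_bochner_integral_iff)
qed

text \<open>Every linear functional of z has the generating function of a centred scalar normal law
  with variance \<open>u \<bullet> (\<Sigma> *v u)\<close>; mixed moments follow by polarisation
  with two coordinate vectors.\<close>

lemma mv_normal_second_moment:
  fixes \<Sigma> :: "real^'d^'d"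
  assumes "invertible \<Sigma>" "transpose \<Sigma> = \<Sigma>" "prob_space (mv_normal \<Sigma>)"
  shows "has_bochner_integral (mv_normal \<Sigma>) (\<lambda>z. z $ i * z $ j) (\<Sigma> $ i $ j)"
proof -
  have sq: "has_bochner_integral (mv_normal \<Sigma>) (\<lambda>z. (u \<bullet> z)\<^sup>2) (u \<bullet> (\<Sigma> *v u))" for u
  proof (rule second_moment_of_mgf)
    fix s :: real
    have "has_bochner_integral (mv_normal \<Sigma>) (\<lambda>z. exp ((s *\<^sub>R u) \<bullet> z)) (exp ((s *\<^sub>R u) \<bullet> (\<Sigma> *v (s *\<^sub>R u)) / 2))"
      by (rule has_bochner_integral_nn_integral) (use mv_normal_mgf[OF assms, of "s *\<^sub>R u"] in auto)
    then show "has_bochner_integral (mv_normal \<Sigma>) (\<lambda>z. exp (s * (u \<bullet> z))) (exp (s\<^sup>2 * (u \<bullet> (\<Sigma> *v u)) / 2))"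
      by (simp add: matrix_vector_mult_scaleR power2_eq_square mult.assoc)
  qed simp
  define a b where "a = (axis i 1 :: real^'d)" and "b = (axis j 1 :: real^'d)"
  have ab: "a \<bullet> z = z $ i" "b \<bullet> z = z $ j" for z by (auto simp: a_def b_def inner_axis')
  have sym: "b \<bullet> (\<Sigma> *v a) = a \<bullet> (\<Sigma> *v b)"
    using assms(2) by (metis dot_lmul_matrix inner_commute vector_transpose_matrix)
  have "has_bochner_integral (mv_normal \<Sigma>) (\<lambda>z. (((a + b) \<bullet> z)\<^sup>2 - (a \<bullet> z)\<^sup>2 - (b \<bullet> z)\<^sup>2) / 2)
      (((a + b) \<bullet> (\<Sigma> *v (a + b)) - a \<bullet> (\<Sigma> *v a) - b \<bullet> (\<Sigma> *v b)) / 2)"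
    by (intro has_bochner_integral_divide_zero has_bochner_integral_diff sq)
  moreover have "(((a + b) \<bullet> z)\<^sup>2 - (a \<bullet> z)\<^sup>2 - (b \<bullet> z)\<^sup>2) / 2 = z $ i * z $ j" for z
    by (simp add: inner_add_left ab power2_eq_square algebra_simps)
  moreover have "((a + b) \<bullet> (\<Sigma> *v (a + b)) - a \<bullet> (\<Sigma> *v a) - b \<bullet> (\<Sigma> *v b)) / 2 = \<Sigma> $ i $ j"
    using sym by (simp add: inner_add_left matrix_vector_right_distrib inner_add_right ab)
      (simp add: b_def matrix_vector_mul_component inner_axis)
  ultimately show ?thesis by simp
qed

section \<open>Convergence of conditional second moments\<close>

text \<open>For c nonzero, \<open>f\<close> and its multiple are integrable together, and a
  non-integrable function has integral 0 on both sides. It rewrites the bootstrap variance for every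
  single sample, where integrability is not known.\<close>

lemma bochner_scaleR_right:
  fixes f :: "'a \<Rightarrow> 'b::{banach, second_countable_topology}"
  shows "(\<integral>x. c *\<^sub>R f x \<partial>M) = c *\<^sub>R (\<integral>x. f x \<partial>M)"
proof (cases "c = 0 \<or> integrable M f")
  case False
  then have "\<not> integrable M (\<lambda>x. c *\<^sub>R f x)"
    using integrable_scaleR_right[of "inverse c" M "\<lambda>x. c *\<^sub>R f x"] by auto
  then show ?thesis using False by (simp add: not_integrable_integral_eq)
qed auto

lemma borel_measurable_vec_nth_cart[measurable]: "(\<lambda>v::real^'n. v $ i) \<in> borel_measurable borel"
  by (intro borel_measurable_continuous_onI continuous_intros)

definition clip :: "real \<Rightarrow> real \<Rightarrow> real" where
  "clip k t = max (- k) (min k t)"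

lemma clip_measurable[measurable]: "clip k \<in> borel_measurable borel"
  unfolding clip_def by measurable

lemma abs_clip_le: "0 \<le> k \<Longrightarrow> \<bar>clip k t\<bar> \<le> k" "0 \<le> k \<Longrightarrow> \<bar>clip k t\<bar> \<le> \<bar>t\<bar>"
  by (auto simp: clip_def)

lemma clip_id: "\<bar>t\<bar> \<le> k \<Longrightarrow> clip k t = t"
  by (auto simp: clip_def)

lemma clip_lipschitz: "\<bar>clip k s - clip k t\<bar> \<le> \<bar>s - t\<bar>"
  by (auto simp: clip_def max_def min_def)

text \<open>The clipped product is bounded by k^2 and has Lipschitz constant at most 2 k, so k \<ge>
  2 lets the single normalisation by k^2 serve both requirements.\<close>

lemma clip_prod_in_BL1:
  assumes "2 \<le> k"
  shows "(\<lambda>v::real^'d. clip k (v $ i) * clip k (v $ j) / k\<^sup>2) \<in> BL1"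
proof -
  have "\<bar>clip k (v $ i) * clip k (v $ j)\<bar> \<le> k\<^sup>2" for v :: "real^'d"
    using abs_clip_le(1)[of k] assms by (auto simp: abs_mult power2_eq_square intro!: mult_mono)
  moreover have "1-lipschitz_on UNIV (\<lambda>v::real^'d. clip k (v $ i) * clip k (v $ j) / k\<^sup>2)"
  proof (rule lipschitz_onI)
    fix u v :: "real^'d"
    have c: "\<bar>clip k (u $ l) - clip k (v $ l)\<bar> \<le> dist u v" for l
      using clip_lipschitz[of k "u $ l" "v $ l"] component_le_norm_cart[of "u - v" l] by (simp add: dist_norm)
    have "\<bar>clip k (u $ i) * clip k (u $ j) - clip k (v $ i) * clip k (v $ j)\<bar>
        = \<bar>clip k (u $ i) * (clip k (u $ j) - clip k (v $ j)) + (clip k (u $ i) - clip k (v $ i)) * clip k (v $ j)\<bar>"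
      by (simp add: algebra_simps)
    also have "\<dots> \<le> \<bar>clip k (u $ i)\<bar> * \<bar>clip k (u $ j) - clip k (v $ j)\<bar> + \<bar>clip k (u $ i) - clip k (v $ i)\<bar> * \<bar>clip k (v $ j)\<bar>"
      by (metis abs_mult abs_triangle_ineq)
    also have "\<dots> \<le> k * dist u v + dist u v * k"
      using c abs_clip_le(1)[of k] assms by (intro add_mono mult_mono) auto
    also have "\<dots> \<le> k\<^sup>2 * dist u v"
      using mult_right_mono[of 2 k "k * dist u v"] assms by (simp add: power2_eq_square mult_ac)
    finally show "dist (clip k (u $ i) * clip k (u $ j) / k\<^sup>2) (clip k (v $ i) * clip k (v $ j) / k\<^sup>2) \<le> 1 * dist u v"
      using assms by (simp add: dist_real_def diff_divide_distrib[symmetric] divide_le_eq mult.commute)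
  qed simp
  ultimately show ?thesis using assms by (auto simp: BL1_def divide_le_eq)
qed

text \<open>Covers non-integrable \<open>f\<close> as well, whose integral is 0 by convention; thus
  the test integrals in \<open>BL_dist\<close> are bounded even for a non-measurable map
  \<open>T\<close>.\<close>

lemma (in prob_space) abs_integral_le_bound:
  fixes f :: "'a \<Rightarrow> real"
  assumes "\<And>x. \<bar>f x\<bar> \<le> B"
  shows "\<bar>\<integral>x. f x \<partial>M\<bar> \<le> B"
proof (cases "integrable M f")
  case True
  have "\<bar>\<integral>x. f x \<partial>M\<bar> \<le> (\<integral>x. \<bar>f x\<bar> \<partial>M)" by (rule integral_abs_bound)
  also have "\<dots> \<le> B" using True assms by (intro integral_le_const) auto
  finally show ?thesis .
next
  case False
  have "0 \<le> B" using assms[of undefined] by linarith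
  with False show ?thesis by (simp add: not_integrable_integral_eq)
qed

definition BL_dist :: "'w measure \<Rightarrow> ('w \<Rightarrow> 'b::metric_space) \<Rightarrow> 'b measure \<Rightarrow> real" where
  "BL_dist M T \<mu> = (SUP f\<in>BL1. \<bar>(\<integral>w. f (T w) \<partial>M) - (\<integral>y. f y \<partial>\<mu>)\<bar>)"

text \<open>A real-valued \<open>SUP\<close> is an upper bound only when the family is bounded
  above; here every member is at most 2, as both measures are probabilities.\<close>

lemma BL_dist_upper:
  assumes "prob_space M" "prob_space \<mu>" "f \<in> BL1"
  shows "\<bar>(\<integral>w. f (T w) \<partial>M) - (\<integral>y. f y \<partial>\<mu>)\<bar> \<le> BL_dist M T \<mu>"
  unfolding BL_dist_def
proof (rule cSUP_upper)
  have "\<bar>(\<integral>w. f (T w) \<partial>M) - (\<integral>y. f y \<partial>\<mu>)\<bar> \<le> 2" if "f \<in> BL1" for f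
  proof -
    have "\<bar>\<integral>w. f (T w) \<partial>M\<bar> \<le> 1" "\<bar>\<integral>y. f y \<partial>\<mu>\<bar> \<le> 1"
      using that by (auto simp: BL1_def intro!: prob_space.abs_integral_le_bound assms)
    then show ?thesis by linarith
  qed
  then show "bdd_above ((\<lambda>f. \<bar>(\<integral>w. f (T w) \<partial>M) - (\<integral>y. f y \<partial>\<mu>)\<bar>) ` BL1)"
    by (intro bdd_aboveI[of _ 2]) auto
qed fact

lemma cond_conv_in_distr_BL_dist:
  assumes "cond_conv_in_distr MX MW T \<mu>" "0 < e"
  shows "(\<lambda>n. outer_measure_of MX {x\<in>space MX. e < BL_dist MW (T n x) \<mu>}) \<longlonglongrightarrow> 0"
proof -
  have "conv_in_prob MX (\<lambda>n x. BL_dist MW (T n x) \<mu>) 0"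
    using assms(1) unfolding cond_conv_in_distr_def BL_dist_def .
  from conv_in_probD[OF this assms(2)] show ?thesis
    by (rule outer_measure_null_subset) (auto simp: dist_real_def intro!: always_eventually)
qed

lemma outer_prod_component: "outer_prod v $ i $ j = v $ i * v $ j"
  by (simp add: outer_prod_def)

lemma outer_prod_scaleR: "outer_prod (a *\<^sub>R v) = a\<^sup>2 *\<^sub>R outer_prod v"
  by (simp add: outer_prod_def vec_eq_iff power2_eq_square mult_ac)

lemma outer_prod_measurable[measurable]: "outer_prod \<in> borel_measurable borel"
  unfolding outer_prod_def by (intro borel_measurable_continuous_onI continuous_intros)

lemma abs_component_mult_le: "\<bar>v $ i * v $ j\<bar> \<le> (norm (v :: real^'d))\<^sup>2"
  unfolding abs_mult power2_eq_square by (intro mult_mono component_le_norm_cart) auto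

lemma norm_outer_prod_le: "norm (outer_prod (v :: real^'d)) \<le> (real CARD('d))\<^sup>2 * (norm v)\<^sup>2"
proof -
  have l1: "norm x \<le> (\<Sum>i\<in>UNIV. norm (x $ i))" for x :: "('b::real_normed_vector)^'d"
    unfolding norm_vec_def by (intro L2_set_le_sum) auto
  have "norm (outer_prod v) \<le> (\<Sum>i\<in>UNIV. norm (outer_prod v $ i))" by (rule l1)
  also have "\<dots> \<le> (\<Sum>i\<in>UNIV. \<Sum>j\<in>UNIV. norm (outer_prod v $ i $ j))" by (intro sum_mono l1)
  also have "\<dots> \<le> (\<Sum>i\<in>(UNIV::'d set). \<Sum>j\<in>(UNIV::'d set). (norm v)\<^sup>2)"
    using abs_component_mult_le[of v] by (intro sum_mono) (simp add: outer_prod_component)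
  finally show ?thesis by (simp add: power2_eq_square mult.assoc)
qed

text \<open>Clipping changes the product of two coordinates only where the norm exceeds k, and there
  both the product and its clipped version are at most the squared norm; hence the factor 2. The
  same split dominates the squared norm by \<open>k\<^sup>2 + t w\<close>, which gives
  integrability.\<close>

lemma (in prob_space) truncated_second_moment:
  fixes Y :: "'a \<Rightarrow> real^'d"
  assumes [measurable]: "Y \<in> borel_measurable M" and "0 < k"
    and tail: "(\<integral>\<^sup>+w. ennreal ((norm (Y w))\<^sup>2) * indicator {w. k < norm (Y w)} w \<partial>M) \<le> ennreal r" and "0 \<le> r"
  shows "integrable M (\<lambda>w. outer_prod (Y w))"
    and "\<bar>(\<integral>w. outer_prod (Y w) \<partial>M) $ i $ j - (\<integral>w. clip k (Y w $ i) * clip k (Y w $ j) \<partial>M)\<bar> \<le> 2 * r"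
proof -
  define t where "t w = (norm (Y w))\<^sup>2 * indicator {w. k < norm (Y w)} w" for w
  have [measurable]: "t \<in> borel_measurable M" unfolding t_def by measurable
  have t0: "0 \<le> t w" for w by (simp add: t_def)
  have "(\<integral>\<^sup>+w. ennreal (t w) \<partial>M) \<le> ennreal r"
    using tail by (simp add: t_def ennreal_mult ennreal_indicator)
  then have t: "integrable M t" "(\<integral>w. t w \<partial>M) \<le> r"
    using \<open>0 \<le> r\<close> t0 by (auto simp: integrable_iff_bounded integral_eq_nn_integral intro!: enn2real_leI
      elim!: order_le_less_trans)
  have sq: "(norm (Y w))\<^sup>2 \<le> k\<^sup>2 + t w" for w
    using \<open>0 < k\<close> by (auto simp: t_def indicator_def intro!: power_mono)
  show int: "integrable M (\<lambda>w. outer_prod (Y w))"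
  proof (rule Bochner_Integration.integrable_bound)
    show "integrable M (\<lambda>w. (real CARD('d))\<^sup>2 * (k\<^sup>2 + t w))" using t by simp
    show "AE w in M. norm (outer_prod (Y w)) \<le> norm ((real CARD('d))\<^sup>2 * (k\<^sup>2 + t w))"
    proof (intro AE_I2)
      fix w
      have "norm (outer_prod (Y w)) \<le> (real CARD('d))\<^sup>2 * (norm (Y w))\<^sup>2" by (rule norm_outer_prod_le)
      also have "\<dots> \<le> (real CARD('d))\<^sup>2 * (k\<^sup>2 + t w)" by (intro mult_left_mono sq) simp
      finally show "norm (outer_prod (Y w)) \<le> norm ((real CARD('d))\<^sup>2 * (k\<^sup>2 + t w))" by simp
    qed
  qed simp
  have lin: "bounded_linear (\<lambda>A::real^'d^'d. A $ i $ j)"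
    by (rule bounded_linear_compose[OF bounded_linear_vec_nth bounded_linear_vec_nth])
  have comp: "integrable M (\<lambda>w. Y w $ i * Y w $ j)"
    "(\<integral>w. outer_prod (Y w) \<partial>M) $ i $ j = (\<integral>w. Y w $ i * Y w $ j \<partial>M)"
    using integrable_bounded_linear[OF lin int] integral_bounded_linear[OF lin int]
    by (simp_all add: outer_prod_component)
  have clipi: "integrable M (\<lambda>w. clip k (Y w $ i) * clip k (Y w $ j))"
  proof (rule integrable_const_bound[where B = "k * k"])
    show "AE w in M. norm (clip k (Y w $ i) * clip k (Y w $ j)) \<le> k * k"
      using \<open>0 < k\<close> abs_clip_le(1)[of k] by (intro AE_I2) (auto simp: abs_mult intro!: mult_mono)
  qed simp
  have "\<bar>(\<integral>w. Y w $ i * Y w $ j \<partial>M) - (\<integral>w. clip k (Y w $ i) * clip k (Y w $ j) \<partial>M)\<bar>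
      = \<bar>\<integral>w. Y w $ i * Y w $ j - clip k (Y w $ i) * clip k (Y w $ j) \<partial>M\<bar>"
    using comp clipi by simp
  also have "\<dots> \<le> (\<integral>w. \<bar>Y w $ i * Y w $ j - clip k (Y w $ i) * clip k (Y w $ j)\<bar> \<partial>M)"
    by (rule integral_abs_bound)
  also have "\<dots> \<le> (\<integral>w. 2 * t w \<partial>M)"
  proof (rule integral_mono)
    fix w
    show "\<bar>Y w $ i * Y w $ j - clip k (Y w $ i) * clip k (Y w $ j)\<bar> \<le> 2 * t w"
    proof (cases "k < norm (Y w)")
      case True
      have "\<bar>clip k (Y w $ i) * clip k (Y w $ j)\<bar> \<le> \<bar>Y w $ i * Y w $ j\<bar>"
        using abs_clip_le(2)[of k] \<open>0 < k\<close> by (auto simp: abs_mult intro!: mult_mono)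
      then show ?thesis using True abs_component_mult_le[of "Y w" i j] by (simp add: t_def)
    next
      case False
      then have "\<bar>Y w $ l\<bar> \<le> k" for l using component_le_norm_cart[of "Y w" l] by linarith
      then show ?thesis by (simp add: clip_id t0)
    qed
  qed (use comp clipi t in auto)
  also have "\<dots> \<le> 2 * r" using t by simp
  finally show "\<bar>(\<integral>w. outer_prod (Y w) \<partial>M) $ i $ j - (\<integral>w. clip k (Y w $ i) * clip k (Y w $ j) \<partial>M)\<bar> \<le> 2 * r"
    by (simp add: comp)
qed

lemma clip_moment_tendsto:
  fixes \<mu> :: "(real^'d) measure"
  assumes [measurable_cong]: "sets \<mu> = sets borel"
    and "\<And>l. integrable \<mu> (\<lambda>z. z $ l * z $ l)" "has_bochner_integral \<mu> (\<lambda>z. z $ i * z $ j) s"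
  shows "(\<lambda>k::nat. \<integral>z. clip (real k) (z $ i) * clip (real k) (z $ j) \<partial>\<mu>) \<longlonglongrightarrow> s"
proof -
  have "(\<lambda>k::nat. \<integral>z. clip (real k) (z $ i) * clip (real k) (z $ j) \<partial>\<mu>) \<longlonglongrightarrow> (\<integral>z. z $ i * z $ j \<partial>\<mu>)"
  proof (rule integral_dominated_convergence)
    show "integrable \<mu> (\<lambda>z. \<bar>z $ i * z $ j\<bar>)" using assms(3) by (auto simp: has_bochner_integral_iff)
    show "AE z in \<mu>. (\<lambda>k. clip (real k) (z $ i) * clip (real k) (z $ j)) \<longlonglongrightarrow> z $ i * z $ j"
    proof (intro AE_I2 tendsto_mult)
      fix z :: "real^'d"
      have "(\<lambda>k. clip (real k) y) \<longlonglongrightarrow> y" for y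
      proof (rule tendsto_eventually)
        have "\<forall>\<^sub>F k in sequentially. \<bar>y\<bar> \<le> real k"
          using filterlim_real_sequentially by (auto simp: filterlim_at_top)
        then show "\<forall>\<^sub>F k in sequentially. clip (real k) y = y"
          by eventually_elim (rule clip_id)
      qed
      then show "(\<lambda>k. clip (real k) (z $ i)) \<longlonglongrightarrow> z $ i" "(\<lambda>k. clip (real k) (z $ j)) \<longlonglongrightarrow> z $ j" by auto
    qed
    show "AE z in \<mu>. norm (clip (real k) (z $ i) * clip (real k) (z $ j)) \<le> \<bar>z $ i * z $ j\<bar>" for k
      by (intro AE_I2) (auto simp: abs_mult intro!: mult_mono abs_clip_le)
  qed measurable
  then show ?thesis using assms(3) by (simp add: has_bochner_integral_iff)
qed

text \<open>The tail bound makes \<open>|T|\<^sup>2\<close> uniformly integrable under the product measure, so that truncating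
  costs little in mean; the truncated product is a multiple of a \<open>BL1\<close> function.\<close>

lemma conditional_second_moment_conv:
  fixes T :: "nat \<Rightarrow> 'a \<Rightarrow> 'w \<Rightarrow> real^'d" and S :: "real^'d^'d"
  assumes "prob_space MX" "prob_space MW" "prob_space \<mu>" and \<mu>: "sets \<mu> = sets borel"
    and T[measurable]: "\<And>n. (\<lambda>(x, w). T n x w) \<in> borel_measurable (MX \<Otimes>\<^sub>M MW)"
    and "2 < p" "0 \<le> B"
    and tail: "\<And>n t. 1 \<le> n \<Longrightarrow> 0 < t \<Longrightarrow>
      emeasure (MX \<Otimes>\<^sub>M MW) {z\<in>space (MX \<Otimes>\<^sub>M MW). t < norm (case z of (x, w) \<Rightarrow> T n x w)} \<le> ennreal (B * t powr - p)"
    and weak: "cond_conv_in_distr MX MW T \<mu>"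
    and moments: "\<And>i j. has_bochner_integral \<mu> (\<lambda>z. z $ i * z $ j) (S $ i $ j)"
  shows "conv_in_prob MX (\<lambda>n x. \<integral>w. outer_prod (T n x w) \<partial>MW) S"
proof (intro conv_in_prob_vec)
  fix i j
  interpret X: prob_space MX by fact
  interpret W: prob_space MW by fact
  interpret mu: prob_space \<mu> by fact
  define V where "V n x = (\<integral>w. outer_prod (T n x w) \<partial>MW)" for n x
  define c where "c k = 4 * B / (1 - 2 powr (2 - p)) * k powr (2 - p)" for k :: real
  show "conv_in_prob MX (\<lambda>n x. (\<integral>w. outer_prod (T n x w) \<partial>MW) $ i $ j) (S $ i $ j)"
    unfolding conv_in_prob_def V_def[symmetric]
  proof (intro allI impI)
    fix e :: real assume "0 < e"
    show "(\<lambda>n. outer_measure_of MX {x\<in>space MX. e < dist (V n x $ i $ j) (S $ i $ j)}) \<longlonglongrightarrow> 0"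
    proof (rule order_tendstoI)
      fix a :: ennreal assume "0 < a"
      then obtain a' where a': "0 < a'" "a' < a" using dense by blast
      \<comment> \<open>\<open>a\<close> may be \<open>top\<close>; a real \<open>b\<close> strictly
        below it provides a budget that can be halved.\<close>
      define b where "b = enn2real a'"
      have b: "0 < b" "ennreal b < a"
        using a' top.extremum_strict[of a] less_top[of a'] by (auto simp: b_def enn2real_positive_iff ennreal_enn2real_if)
      \<comment> \<open>The truncation level k must make the clipped moment of the limit law
        accurate to e/3, and also make the mean tail \<open>c k\<close>, divided by e/6 in Markov's
        inequality, smaller than half the budget \<open>b\<close>.\<close>
      have "\<forall>\<^sub>F k in sequentially. dist (\<integral>z. clip (real k) (z $ i) * clip (real k) (z $ j) \<partial>\<mu>) (S $ i $ j) < e / 3"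
        using clip_moment_tendsto[OF \<mu> _ moments[of i j]] moments \<open>0 < e\<close>
        by (intro tendstoD) (auto simp: has_bochner_integral_iff)
      moreover have "\<forall>\<^sub>F k in sequentially. c (real k) * (6 / e) < b / 2"
      proof -
        have "(\<lambda>k. c (real k) * (6 / e)) \<longlonglongrightarrow> 4 * B / (1 - 2 powr (2 - p)) * 0 * (6 / e)"
          unfolding c_def using \<open>2 < p\<close>
          by (intro tendsto_intros tendsto_neg_powr filterlim_real_sequentially) auto
        then show ?thesis using b by (intro order_tendstoD) auto
      qed
      moreover have "\<forall>\<^sub>F k in sequentially. 2 \<le> k" by (rule eventually_ge_at_top)
      ultimately have "\<forall>\<^sub>F k in sequentially. 2 \<le> k \<and> c (real k) * (6 / e) < b / 2 \<and>
        dist (\<integral>z. clip (real k) (z $ i) * clip (real k) (z $ j) \<partial>\<mu>) (S $ i $ j) < e / 3"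
        by eventually_elim auto
      then obtain k :: nat where k: "2 \<le> k" "c (real k) * (6 / e) < b / 2"
        "dist (\<integral>z. clip (real k) (z $ i) * clip (real k) (z $ j) \<partial>\<mu>) (S $ i $ j) < e / 3"
        by (metis (mono_tags, lifting) eventually_sequentially order_refl)
      \<comment> \<open>The conditional tail second moment given the sample. By Tonelli its mean
        over the data is the joint tail integral, which is where the unconditional bound
        \<open>tail\<close> enters.\<close>
      define g where "g n x = (\<integral>\<^sup>+w. ennreal ((norm (T n x w))\<^sup>2) * indicator {w. real k < norm (T n x w)} w \<partial>MW)" for n x
      have gm[measurable]: "g n \<in> borel_measurable MX" for n
        unfolding g_def indicator_def by measurable
      have c0: "0 \<le> c (real k)"
      proof -
        have "2 powr (2 - p) < 1" using \<open>2 < p\<close> by (auto simp: powr_less_one)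
        then show ?thesis using \<open>0 \<le> B\<close> by (simp add: c_def)
      qed
      have g_int: "(\<integral>\<^sup>+x. g n x \<partial>MX) \<le> ennreal (c (real k))" if "1 \<le> n" for n
      proof -
        have "(\<integral>\<^sup>+x. g n x \<partial>MX) = (\<integral>\<^sup>+z. ennreal ((norm (case z of (x, w) \<Rightarrow> T n x w))\<^sup>2) *
            indicator {z. real k < norm (case z of (x, w) \<Rightarrow> T n x w)} z \<partial>(MX \<Otimes>\<^sub>M MW))"
          unfolding g_def by (subst W.nn_integral_fst[symmetric]) (auto simp: indicator_def)
        also have "\<dots> \<le> ennreal (c (real k))"
          unfolding c_def using tail[OF that] \<open>2 < p\<close> \<open>0 \<le> B\<close> k by (intro nn_integral_square_tail) auto
        finally show ?thesis .
      qed
      have g_small: "emeasure MX {x\<in>space MX. ennreal (e / 6) \<le> g n x} \<le> ennreal (b / 2)" if "1 \<le> n" for n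
      proof -
        have "emeasure MX {x\<in>space MX. ennreal (e / 6) \<le> g n x} \<le> emeasure MX {x\<in>space MX. 1 \<le> ennreal (6 / e) * g n x}"
        proof (intro emeasure_mono subsetI)
          fix x assume x: "x \<in> {x\<in>space MX. ennreal (e / 6) \<le> g n x}"
          have "1 = ennreal (6 / e) * ennreal (e / 6)" using \<open>0 < e\<close> by (simp add: ennreal_mult[symmetric])
          also have "\<dots> \<le> ennreal (6 / e) * g n x" using x by (intro mult_left_mono) auto
          finally show "x \<in> {x\<in>space MX. 1 \<le> ennreal (6 / e) * g n x}" using x by auto
        qed measurable
        also have "\<dots> \<le> ennreal (6 / e) * (\<integral>\<^sup>+x. g n x * indicator (space MX) x \<partial>MX)"
          by (rule nn_integral_Markov_inequality) auto
        also have "(\<integral>\<^sup>+x. g n x * indicator (space MX) x \<partial>MX) = (\<integral>\<^sup>+x. g n x \<partial>MX)"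
          by (intro nn_integral_cong) auto
        also have "ennreal (6 / e) * (\<integral>\<^sup>+x. g n x \<partial>MX) \<le> ennreal (6 / e) * ennreal (c (real k))"
          using g_int[OF that] by (intro mult_left_mono) auto
        also have "\<dots> \<le> ennreal (b / 2)"
          using k(2) c0 \<open>0 < e\<close> by (simp add: ennreal_mult[symmetric] mult.commute ennreal_leI)
        finally show ?thesis .
      qed
      \<comment> \<open>Division by k^2 compensates the normalisation that puts the clipped product
        into \<open>BL1\<close>.\<close>
      define r where "r = e / 3 / (real k)\<^sup>2"
      have "0 < r" using k \<open>0 < e\<close> by (simp add: r_def)
      \<comment> \<open>A statement about one fixed sample: truncation costs 2 (e/6), the bounded
        Lipschitz distance e/3, and clipping the limit moment less than e/3.\<close>
      have sub: "{x\<in>space MX. e < dist (V n x $ i $ j) (S $ i $ j)}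
          \<subseteq> {x\<in>space MX. ennreal (e / 6) \<le> g n x} \<union> {x\<in>space MX. r < BL_dist MW (T n x) \<mu>}" for n
      proof (intro subsetI, rule ccontr)
        fix x assume x: "x \<in> {x\<in>space MX. e < dist (V n x $ i $ j) (S $ i $ j)}"
          and "x \<notin> {x\<in>space MX. ennreal (e / 6) \<le> g n x} \<union> {x\<in>space MX. r < BL_dist MW (T n x) \<mu>}"
        then have gx: "g n x \<le> ennreal (e / 6)" and D: "BL_dist MW (T n x) \<mu> \<le> r" by auto
        have [measurable]: "T n x \<in> borel_measurable MW"
          using measurable_Pair2[OF T[of n], of x] x by simp
        let ?\<psi> = "\<lambda>v::real^'d. clip (real k) (v $ i) * clip (real k) (v $ j)"
        have scale: "\<bar>a - b\<bar> \<le> s" if "0 < K" "\<bar>a / K - b / K\<bar> \<le> s / K" for K a b s :: real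
          using that by (simp add: diff_divide_distrib[symmetric] divide_le_cancel)
        have 1: "\<bar>V n x $ i $ j - (\<integral>w. ?\<psi> (T n x w) \<partial>MW)\<bar> \<le> 2 * (e / 6)"
          unfolding V_def using gx k \<open>0 < e\<close>
          by (intro W.truncated_second_moment(2)) (auto simp: g_def)
        have "\<bar>(\<integral>w. ?\<psi> (T n x w) / (real k)\<^sup>2 \<partial>MW) - (\<integral>z. ?\<psi> z / (real k)\<^sup>2 \<partial>\<mu>)\<bar> \<le> r"
          using BL_dist_upper[OF \<open>prob_space MW\<close> \<open>prob_space \<mu>\<close> clip_prod_in_BL1[of "real k" i j], of "T n x"] k D by simp
        then have 2: "\<bar>(\<integral>w. ?\<psi> (T n x w) \<partial>MW) - (\<integral>z. ?\<psi> z \<partial>\<mu>)\<bar> \<le> e / 3"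
          using scale[of "(real k)\<^sup>2" _ _ "e / 3"] k unfolding r_def by simp
        have "e < \<bar>V n x $ i $ j - S $ i $ j\<bar>" using x by (simp add: dist_real_def)
        then show False using 1 2 k(3) unfolding dist_real_def by linarith
      qed
      have "\<forall>\<^sub>F n in sequentially. outer_measure_of MX {x\<in>space MX. r < BL_dist MW (T n x) \<mu>} < ennreal (b / 2)"
        using cond_conv_in_distr_BL_dist[OF weak \<open>0 < r\<close>] b by (intro order_tendstoD) auto
      moreover have "\<forall>\<^sub>F n in sequentially. (1::nat) \<le> n" by (rule eventually_ge_at_top)
      ultimately show "\<forall>\<^sub>F n in sequentially. outer_measure_of MX {x\<in>space MX. e < dist (V n x $ i $ j) (S $ i $ j)} < a"
      proof eventually_elim
        case (elim n)
        have "outer_measure_of MX {x\<in>space MX. e < dist (V n x $ i $ j) (S $ i $ j)}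
            \<le> outer_measure_of MX {x\<in>space MX. ennreal (e / 6) \<le> g n x} + outer_measure_of MX {x\<in>space MX. r < BL_dist MW (T n x) \<mu>}"
          using outer_measure_of_mono[OF sub] outer_measure_of_Un_le by (rule order_trans)
        also have "\<dots> \<le> ennreal (b / 2) + ennreal (b / 2)"
          using elim g_small[of n] by (intro add_mono) auto
        also have "\<dots> = ennreal b" using b by (simp add: ennreal_plus[symmetric] del: ennreal_plus)
        finally show ?case using b by simp
      qed
    qed auto
  qed
qed

section \<open>Tail bounds for the estimators\<close>

lemma emp_diff: "emp n xs (\<lambda>x. f x - g x) = emp n xs f - emp n xs g"
  by (simp add: emp_def sum_subtractf diff_divide_distrib)

lemma boot_emp_diff: "boot_emp n xs ws (\<lambda>x. f x - g x) = boot_emp n xs ws f - boot_emp n xs ws g"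
  by (simp add: boot_emp_def sum_subtractf diff_divide_distrib right_diff_distrib)

lemma is_argsup_ge:
  assumes "is_argsup E m \<Theta> H t h" "a \<in> \<Theta>" "b \<in> H"
  shows "t \<in> \<Theta>" "h \<in> H" "E (m a b) \<le> E (m t h)"
proof -
  show "t \<in> \<Theta>" "h \<in> H" using assms by (auto simp: is_argsup_def is_arg_max_def)
  have "\<not> E (m a b) > E (m t h)"
    using assms unfolding is_argsup_def is_arg_max_def by (auto dest: spec[of _ "(a, b)"])
  then show "E (m a b) \<le> E (m t h)" by simp
qed

lemma increment_quadratic_bound:
  fixes a b I :: real
  assumes "0 < K" "I \<le> - K * (a\<^sup>2 + b\<^sup>2)"
  shows "K * (max a b)\<^sup>2 \<le> - I"
proof -
  have "(max a b)\<^sup>2 \<le> a\<^sup>2 + b\<^sup>2" by (auto simp: max_def)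
  from mult_left_mono[OF this, of K] assms show ?thesis unfolding mult_minus_left by linarith
qed

text \<open>Maximality makes the empirical mean of the increment at the estimator nonnegative, while
  M1 puts its expectation below -K R^2; the gap is the centred empirical mean. The increment lies in
  the class of radius \<delta> as soon as R \<le> \<delta>.\<close>

lemma emp_maximizer_increment:
  fixes m :: "'t::real_normed_vector \<Rightarrow> 'h \<Rightarrow> 'x \<Rightarrow> real"
  assumes "0 < K" "\<theta>0 \<in> \<Theta>" "\<eta>0 \<in> H"
    and M1: "\<And>\<theta> \<eta>. \<theta> \<in> \<Theta> \<Longrightarrow> \<eta> \<in> H \<Longrightarrow>
      (\<integral>x. m \<theta> \<eta> x - m \<theta>0 \<eta>0 x \<partial>P) \<le> - K * ((norm (\<theta> - \<theta>0))\<^sup>2 + (d \<eta> \<eta>0)\<^sup>2)"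
    and arg: "is_argsup (emp n xs) m \<Theta> H t h"
    and R: "max (norm (t - \<theta>0)) (d h \<eta>0) \<le> \<delta>"
  shows "ennreal (sqrt (real n) * K * (max (norm (t - \<theta>0)) (d h \<eta>0))\<^sup>2)
      \<le> sup_over (emp_process P n xs) (increment_class m \<Theta> H d \<theta>0 \<eta>0 \<delta>)"
proof -
  let ?f = "\<lambda>x. m t h x - m \<theta>0 \<eta>0 x"
  note a = is_argsup_ge[OF arg assms(2,3)]
  have f: "?f \<in> increment_class m \<Theta> H d \<theta>0 \<eta>0 \<delta>" using a R by (auto simp: increment_class_def)
  have "K * (max (norm (t - \<theta>0)) (d h \<eta>0))\<^sup>2 \<le> emp n xs ?f - (\<integral>x. ?f x \<partial>P)"
    using increment_quadratic_bound[OF \<open>0 < K\<close> M1[OF a(1,2)]] a(3) by (simp add: emp_diff)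
  then have "sqrt (real n) * K * (max (norm (t - \<theta>0)) (d h \<eta>0))\<^sup>2 \<le> \<bar>emp_process P n xs ?f\<bar>"
    unfolding emp_process_def mult.assoc by (intro order_trans[OF mult_left_mono abs_ge_self]) auto
  then have "ennreal (sqrt (real n) * K * (max (norm (t - \<theta>0)) (d h \<eta>0))\<^sup>2) \<le> ennreal \<bar>emp_process P n xs ?f\<bar>"
    by (rule ennreal_leI)
  also have "\<dots> \<le> sup_over (emp_process P n xs) (increment_class m \<Theta> H d \<theta>0 \<eta>0 \<delta>)"
    unfolding sup_over_def using f by (rule SUP_upper)
  finally show ?thesis .
qed

text \<open>Same inequality with the weighted mean; its deviation from the expectation splits into
  weighted minus empirical mean plus empirical mean minus expectation, so two suprema
  appear.\<close>

lemma boot_maximizer_increment: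
  fixes m :: "'t::real_normed_vector \<Rightarrow> 'h \<Rightarrow> 'x \<Rightarrow> real"
  assumes "0 < K" "\<theta>0 \<in> \<Theta>" "\<eta>0 \<in> H"
    and M1: "\<And>\<theta> \<eta>. \<theta> \<in> \<Theta> \<Longrightarrow> \<eta> \<in> H \<Longrightarrow>
      (\<integral>x. m \<theta> \<eta> x - m \<theta>0 \<eta>0 x \<partial>P) \<le> - K * ((norm (\<theta> - \<theta>0))\<^sup>2 + (d \<eta> \<eta>0)\<^sup>2)"
    and arg: "is_argsup (boot_emp n xs ws) m \<Theta> H t h"
    and R: "max (norm (t - \<theta>0)) (d h \<eta>0) \<le> \<delta>"
  shows "ennreal (sqrt (real n) * K * (max (norm (t - \<theta>0)) (d h \<eta>0))\<^sup>2)
      \<le> sup_over (emp_process P n xs) (increment_class m \<Theta> H d \<theta>0 \<eta>0 \<delta>)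
        + sup_over (boot_process n xs ws) (increment_class m \<Theta> H d \<theta>0 \<eta>0 \<delta>)"
proof -
  let ?f = "\<lambda>x. m t h x - m \<theta>0 \<eta>0 x"
  note a = is_argsup_ge[OF arg assms(2,3)]
  have f: "?f \<in> increment_class m \<Theta> H d \<theta>0 \<eta>0 \<delta>" using a R by (auto simp: increment_class_def)
  have "K * (max (norm (t - \<theta>0)) (d h \<eta>0))\<^sup>2 \<le> boot_emp n xs ws ?f - (\<integral>x. ?f x \<partial>P)"
    using increment_quadratic_bound[OF \<open>0 < K\<close> M1[OF a(1,2)]] a(3) by (simp add: boot_emp_diff)
  then have "sqrt (real n) * K * (max (norm (t - \<theta>0)) (d h \<eta>0))\<^sup>2 \<le> sqrt (real n) * (boot_emp n xs ws ?f - (\<integral>x. ?f x \<partial>P))"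
    unfolding mult.assoc by (intro mult_left_mono) auto
  also have "\<dots> = emp_process P n xs ?f + boot_process n xs ws ?f"
    by (simp add: emp_process_def boot_process_def right_diff_distrib)
  also have "\<dots> \<le> \<bar>emp_process P n xs ?f\<bar> + \<bar>boot_process n xs ws ?f\<bar>" by simp
  finally have "ennreal (sqrt (real n) * K * (max (norm (t - \<theta>0)) (d h \<eta>0))\<^sup>2)
      \<le> ennreal \<bar>emp_process P n xs ?f\<bar> + ennreal \<bar>boot_process n xs ws ?f\<bar>"
    by (simp add: ennreal_plus[symmetric] ennreal_leI del: ennreal_plus)
  also have "\<dots> \<le> sup_over (emp_process P n xs) (increment_class m \<Theta> H d \<theta>0 \<eta>0 \<delta>)
        + sup_over (boot_process n xs ws) (increment_class m \<Theta> H d \<theta>0 \<eta>0 \<delta>)"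
    unfolding sup_over_def using f by (intro add_mono SUP_upper)
  finally show ?thesis .
qed

text \<open>Peeling with curvature \<open>sqrt (real n) * K\<close> and radius
  \<open>t / sqrt (real n)\<close>: the powers of n cancel, so the constant is uniform in n.\<close>

lemma root_n_tail:
  fixes R :: "'a \<Rightarrow> real"
  assumes "2 < p" "0 < C" "0 < K" "1 \<le> n" "0 < t"
    and "AE x in M. \<forall>\<delta>>0. R x \<le> \<delta> \<longrightarrow> ennreal (sqrt (real n) * K * (R x)\<^sup>2) \<le> S \<delta> x + T \<delta> x"
    and "\<And>\<delta> s. 0 < \<delta> \<Longrightarrow> 0 < s \<Longrightarrow> outer_measure_of M {x\<in>space M. ennreal s \<le> S \<delta> x} \<le> ennreal ((C * \<delta> / s) powr p)"
    and "\<And>\<delta> s. 0 < \<delta> \<Longrightarrow> 0 < s \<Longrightarrow> outer_measure_of M {x\<in>space M. ennreal s \<le> T \<delta> x} \<le> ennreal ((C * \<delta> / s) powr p)"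
  shows "outer_measure_of M {x\<in>space M. t < sqrt (real n) * R x} \<le> ennreal (4 * (4 * C / K) powr p * t powr - p)"
proof -
  have n: "0 < sqrt (real n)" using \<open>1 \<le> n\<close> by simp
  have a: "(a / t) powr p = a powr p * t powr - p" if "0 \<le> a" for a
    using that \<open>0 < t\<close> by (simp add: powr_divide powr_minus_divide)
  have C: "4 * C / (sqrt (real n) * K * (t / sqrt (real n))) = 4 * C / K / t" using n by simp
  have set: "{x\<in>space M. t / sqrt (real n) < R x} = {x\<in>space M. t < sqrt (real n) * R x}"
    using n by (auto simp: divide_less_eq mult.commute)
  have "outer_measure_of M {x\<in>space M. t / sqrt (real n) < R x}
      \<le> ennreal (4 * (4 * C / (sqrt (real n) * K * (t / sqrt (real n)))) powr p)"
    using assms n by (intro peeling_tail[where S = S and T = T]) auto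
  then show ?thesis
    unfolding C set using a[of "4 * C / K"] assms by (simp add: mult.assoc)
qed

lemma obs_measurable:
  assumes "prob_space MX" "iid_data MX P X"
  shows "obs X n \<in> measurable MX (\<Pi>\<^sub>M i\<in>{..<n}. P)"
proof -
  interpret prob_space MX by fact
  have "X i \<in> measurable MX P" for i
    using assms(2) by (auto simp: iid_data_def indep_vars_def)
  then show ?thesis unfolding obs_def by (intro measurable_restrict)
qed

lemma wvec_measurable:
  assumes "\<And>n i. i < n \<Longrightarrow> W n i \<in> borel_measurable MW"
  shows "wvec W n \<in> measurable MW (\<Pi>\<^sub>M i\<in>{..<n}. borel)"
  unfolding wvec_def using assms by (intro measurable_restrict) auto

text \<open>The peeled distance is the maximum of the parametric and nuisance errors, since M1 and
  the classes of M2 involve both. Only the parametric part is kept at the end, and its event is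
  measurable, so the outer bound becomes an \<open>emeasure\<close> bound.\<close>

lemma estimator_tails:
  fixes MX :: "'a measure" and MW :: "'w measure" and m :: "real^'d \<Rightarrow> 'h \<Rightarrow> 'x \<Rightarrow> real"
  assumes MX: "prob_space MX" and MW: "prob_space MW"
    and iid: "iid_data MX PX X"
    and W: "\<And>n i. i < n \<Longrightarrow> W n i \<in> borel_measurable MW"
    and center: "\<theta>0 \<in> \<Theta>" "\<eta>0 \<in> H"
    and th_meas: "\<And>n. th n \<in> borel_measurable (\<Pi>\<^sub>M i\<in>{..<n}. PX)"
    and thb_meas: "\<And>n. (\<lambda>(xs, ws). thb n xs ws)
          \<in> borel_measurable ((\<Pi>\<^sub>M i\<in>{..<n}. PX) \<Otimes>\<^sub>M (\<Pi>\<^sub>M i\<in>{..<n}. borel))"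
    and estimator: "\<And>n. 1 \<le> n \<Longrightarrow> AE x in MX.
          is_argsup (emp n (obs X n x)) m \<Theta> H (th n (obs X n x)) (et n (obs X n x))"
    and boot_estimator: "\<And>n. 1 \<le> n \<Longrightarrow> AE (x, w) in MX \<Otimes>\<^sub>M MW.
          is_argsup (boot_emp n (obs X n x) (wvec W n w)) m \<Theta> H
            (thb n (obs X n x) (wvec W n w)) (etb n (obs X n x) (wvec W n w))"
    and M1: "\<exists>K>0. \<forall>\<theta>\<in>\<Theta>. \<forall>\<eta>\<in>H.
          (\<integral>x. m \<theta> \<eta> x - m \<theta>0 \<eta>0 x \<partial>PX) \<le> - K * ((norm (\<theta> - \<theta>0))\<^sup>2 + (d \<eta> \<eta>0)\<^sup>2)"
    and M2: "\<exists>p>2. \<exists>C. \<forall>\<delta>>0. \<forall>n\<ge>1.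
          outer_Lp_norm MX p (\<lambda>x. sup_over (emp_process PX n (obs X n x))
              (increment_class m \<Theta> H d \<theta>0 \<eta>0 \<delta>)) \<le> ennreal (C * \<delta>) \<and>
          outer_Lp_norm (MX \<Otimes>\<^sub>M MW) p (\<lambda>(x, w). sup_over (boot_process n (obs X n x) (wvec W n w))
              (increment_class m \<Theta> H d \<theta>0 \<eta>0 \<delta>)) \<le> ennreal (C * \<delta>)"
  obtains p B where "2 < p" "0 \<le> B"
    and "\<And>n t. 1 \<le> n \<Longrightarrow> 0 < t \<Longrightarrow>
      emeasure MX {x\<in>space MX. t < sqrt (real n) * norm (th n (obs X n x) - \<theta>0)} \<le> ennreal (B * t powr - p)"
    and "\<And>n t. 1 \<le> n \<Longrightarrow> 0 < t \<Longrightarrow>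
      emeasure (MX \<Otimes>\<^sub>M MW) {z\<in>space (MX \<Otimes>\<^sub>M MW).
        t < sqrt (real n) * norm (thb n (obs X n (fst z)) (wvec W n (snd z)) - \<theta>0)} \<le> ennreal (B * t powr - p)"
proof -
  interpret X: prob_space MX by fact
  interpret W: prob_space MW by fact
  note [measurable] = obs_measurable[OF MX iid] wvec_measurable[of W, OF W] th_meas
  obtain K where K: "0 < K" "\<And>\<theta> \<eta>. \<theta> \<in> \<Theta> \<Longrightarrow> \<eta> \<in> H \<Longrightarrow>
      (\<integral>x. m \<theta> \<eta> x - m \<theta>0 \<eta>0 x \<partial>PX) \<le> - K * ((norm (\<theta> - \<theta>0))\<^sup>2 + (d \<eta> \<eta>0)\<^sup>2)"
    using M1 by blast
  define S where "S n \<delta> x = sup_over (emp_process PX n (obs X n x)) (increment_class m \<Theta> H d \<theta>0 \<eta>0 \<delta>)" for n \<delta> x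
  define T where "T n \<delta> z = (case z of (x, w) \<Rightarrow> sup_over (boot_process n (obs X n x) (wvec W n w))
              (increment_class m \<Theta> H d \<theta>0 \<eta>0 \<delta>))" for n \<delta> z
  obtain p C0 where p: "2 < p" and C0: "\<And>\<delta> n. 0 < \<delta> \<Longrightarrow> 1 \<le> n \<Longrightarrow> outer_Lp_norm MX p (S n \<delta>) \<le> ennreal (C0 * \<delta>)"
    "\<And>\<delta> n. 0 < \<delta> \<Longrightarrow> 1 \<le> n \<Longrightarrow> outer_Lp_norm (MX \<Otimes>\<^sub>M MW) p (T n \<delta>) \<le> ennreal (C0 * \<delta>)"
    using M2 unfolding S_def[abs_def] T_def[abs_def] by blast
  \<comment> \<open>M2 gives no sign for its constant; the Markov and peeling bounds want a positive
    one.\<close>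
  define C where "C = max C0 1"
  have "0 < C" by (simp add: C_def)
  have C: "ennreal (C0 * \<delta>) \<le> ennreal (C * \<delta>)" if "0 < \<delta>" for \<delta>
    using that by (intro ennreal_leI mult_right_mono) (auto simp: C_def)
  have S_tail: "outer_measure_of MX {x\<in>space MX. ennreal s \<le> S n \<delta> x} \<le> ennreal ((C * \<delta> / s) powr p)"
    if "0 < \<delta>" "0 < s" "1 \<le> n" for n \<delta> s
    using order_trans[OF C0(1) C] that p \<open>0 < C\<close> by (intro outer_Lp_norm_Markov) auto
  have T_tail: "outer_measure_of (MX \<Otimes>\<^sub>M MW) {z\<in>space (MX \<Otimes>\<^sub>M MW). ennreal s \<le> T n \<delta> z} \<le> ennreal ((C * \<delta> / s) powr p)"
    if "0 < \<delta>" "0 < s" "1 \<le> n" for n \<delta> s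
    using order_trans[OF C0(2) C] that p \<open>0 < C\<close> by (intro outer_Lp_norm_Markov) auto
  have S_tail': "outer_measure_of (MX \<Otimes>\<^sub>M MW) {z\<in>space (MX \<Otimes>\<^sub>M MW). ennreal s \<le> S n \<delta> (fst z)} \<le> ennreal ((C * \<delta> / s) powr p)"
    if "0 < \<delta>" "0 < s" "1 \<le> n" for n \<delta> s
  proof -
    have "{z\<in>space (MX \<Otimes>\<^sub>M MW). ennreal s \<le> S n \<delta> (fst z)} = {x\<in>space MX. ennreal s \<le> S n \<delta> x} \<times> space MW"
      by (auto simp: space_pair_measure)
    then show ?thesis
      using outer_measure_of_pair_fst[OF MW, of "{x\<in>space MX. ennreal s \<le> S n \<delta> x}" MX] S_tail[OF that]
      by (auto intro: order_trans)
  qed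
  define B where "B = 4 * (4 * C / K) powr p"
  show thesis
  proof (rule that)
    show "2 < p" "0 \<le> B" using p by (auto simp: B_def)
    fix n :: nat and t :: real assume n: "1 \<le> n" and t: "0 < t"
    define R where "R x = max (norm (th n (obs X n x) - \<theta>0)) (d (et n (obs X n x)) \<eta>0)" for x
    \<comment> \<open>The unweighted estimator involves one process only; repeating \<open>S\<close>
      fits it into the two-process peeling bound.\<close>
    have "AE x in MX. \<forall>\<delta>>0. R x \<le> \<delta> \<longrightarrow> ennreal (sqrt (real n) * K * (R x)\<^sup>2) \<le> S n \<delta> x + S n \<delta> x"
      using estimator[OF n]
    proof eventually_elim
      case (elim x)
      have "ennreal (sqrt (real n) * K * (R x)\<^sup>2) \<le> S n \<delta> x" if "R x \<le> \<delta>" for \<delta>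
        using emp_maximizer_increment[where d = d, OF K(1) center K(2) elim] that unfolding R_def S_def by blast
      then show ?case by (intro allI impI add_increasing[OF zero_le])
    qed
    from root_n_tail[OF p \<open>0 < C\<close> K(1) n t this S_tail[OF _ _ n] S_tail[OF _ _ n]]
    have "outer_measure_of MX {x\<in>space MX. t < sqrt (real n) * R x} \<le> ennreal (B * t powr - p)"
      unfolding B_def .
    moreover have "{x\<in>space MX. t < sqrt (real n) * norm (th n (obs X n x) - \<theta>0)} \<subseteq> {x\<in>space MX. t < sqrt (real n) * R x}"
      by (auto simp: R_def elim!: order_less_le_trans intro!: mult_left_mono)
    then have "outer_measure_of MX {x\<in>space MX. t < sqrt (real n) * norm (th n (obs X n x) - \<theta>0)}
        \<le> outer_measure_of MX {x\<in>space MX. t < sqrt (real n) * R x}" by (rule outer_measure_of_mono)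
    moreover have "{x\<in>space MX. t < sqrt (real n) * norm (th n (obs X n x) - \<theta>0)} \<in> sets MX" by measurable
    ultimately show "emeasure MX {x\<in>space MX. t < sqrt (real n) * norm (th n (obs X n x) - \<theta>0)} \<le> ennreal (B * t powr - p)"
      by (auto intro: order_trans)
    define R' where "R' z = (case z of (x, w) \<Rightarrow> max (norm (thb n (obs X n x) (wvec W n w) - \<theta>0))
      (d (etb n (obs X n x) (wvec W n w)) \<eta>0))" for z
    have "AE z in MX \<Otimes>\<^sub>M MW. \<forall>\<delta>>0. R' z \<le> \<delta> \<longrightarrow> ennreal (sqrt (real n) * K * (R' z)\<^sup>2) \<le> S n \<delta> (fst z) + T n \<delta> z"
      using boot_estimator[OF n]
    proof eventually_elim
      case (elim z)
      obtain x w where z: "z = (x, w)" by (cases z)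
      have e: "is_argsup (boot_emp n (obs X n x) (wvec W n w)) m \<Theta> H
            (thb n (obs X n x) (wvec W n w)) (etb n (obs X n x) (wvec W n w))" using elim z by simp
      have "ennreal (sqrt (real n) * K * (R' z)\<^sup>2) \<le> S n \<delta> (fst z) + T n \<delta> z" if "R' z \<le> \<delta>" for \<delta>
        using boot_maximizer_increment[where d = d, OF K(1) center K(2) e] that
        unfolding R'_def S_def T_def z prod.case fst_conv by blast
      then show ?case by blast
    qed
    from root_n_tail[OF p \<open>0 < C\<close> K(1) n t this S_tail'[OF _ _ n] T_tail[OF _ _ n]]
    have "outer_measure_of (MX \<Otimes>\<^sub>M MW) {z\<in>space (MX \<Otimes>\<^sub>M MW). t < sqrt (real n) * R' z} \<le> ennreal (B * t powr - p)"
      unfolding B_def .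
    moreover have "{z\<in>space (MX \<Otimes>\<^sub>M MW). t < sqrt (real n) * norm (thb n (obs X n (fst z)) (wvec W n (snd z)) - \<theta>0)}
        \<subseteq> {z\<in>space (MX \<Otimes>\<^sub>M MW). t < sqrt (real n) * R' z}"
    proof safe
      fix x w assume t: "t < sqrt (real n) * norm (thb n (obs X n (fst (x, w))) (wvec W n (snd (x, w))) - \<theta>0)"
      have "sqrt (real n) * norm (thb n (obs X n x) (wvec W n w) - \<theta>0) \<le> sqrt (real n) * R' (x, w)"
        unfolding R'_def by (intro mult_left_mono) auto
      then show "t < sqrt (real n) * R' (x, w)" using t by simp
    qed
    then have "outer_measure_of (MX \<Otimes>\<^sub>M MW) {z\<in>space (MX \<Otimes>\<^sub>M MW). t < sqrt (real n) * norm (thb n (obs X n (fst z)) (wvec W n (snd z)) - \<theta>0)}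
        \<le> outer_measure_of (MX \<Otimes>\<^sub>M MW) {z\<in>space (MX \<Otimes>\<^sub>M MW). t < sqrt (real n) * R' z}" by (rule outer_measure_of_mono)
    moreover have "{z\<in>space (MX \<Otimes>\<^sub>M MW). t < sqrt (real n) * norm (thb n (obs X n (fst z)) (wvec W n (snd z)) - \<theta>0)} \<in> sets (MX \<Otimes>\<^sub>M MW)"
    proof -
      have [measurable]: "(\<lambda>z. thb n (obs X n (fst z)) (wvec W n (snd z))) \<in> borel_measurable (MX \<Otimes>\<^sub>M MW)"
        using measurable_compose[OF _ thb_meas[of n], of "\<lambda>z. (obs X n (fst z), wvec W n (snd z))" "MX \<Otimes>\<^sub>M MW"] by simp
      show ?thesis by measurable
    qed
    ultimately show "emeasure (MX \<Otimes>\<^sub>M MW) {z\<in>space (MX \<Otimes>\<^sub>M MW).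
        t < sqrt (real n) * norm (thb n (obs X n (fst z)) (wvec W n (snd z)) - \<theta>0)} \<le> ennreal (B * t powr - p)"
      by (auto intro: order_trans)
  qed
qed

section \<open>Dimension one: quantiles and coverage\<close>

lemma all_index_one_dim:
  assumes "UNIV = {i::'n::finite}"
  shows "(\<forall>j::'n. P j) \<longleftrightarrow> P i"
  using assms by (metis UNIV_I singletonD)

lemma one_dim_matrix:
  assumes "UNIV = {i::'n::finite}"
  shows "(A::real^'n^'n) = mat (A $ i $ i)" "mat a $ i $ i = (a::real)"
    "(A *v v) $ i = A $ i $ i * v $ i" "((A::real^'n^'n) ** B) $ i $ i = A $ i $ i * B $ i $ i"
    "((v::real^'n) \<le> w) = (v $ i \<le> w $ i)" "(v::real^'n) \<bullet> w = v $ i * w $ i"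
    "transpose A = A"
  by (simp_all add: vec_eq_iff mat_def transpose_def matrix_vector_mult_def matrix_matrix_mult_def
      less_eq_vec_def inner_vec_def all_index_one_dim[OF assms]) (simp_all add: assms)

lemma psd_matrix_one_dim:
  assumes "UNIV = {i::'n::finite}"
  shows "psd_matrix (A::real^'n^'n) \<longleftrightarrow> 0 \<le> A $ i $ i"
proof
  assume "psd_matrix A"
  then have "0 \<le> (\<chi> _. 1) \<bullet> (A *v (\<chi> _. 1))" unfolding psd_matrix_def by blast
  then show "0 \<le> A $ i $ i" by (simp add: one_dim_matrix[OF assms])
next
  assume a: "0 \<le> A $ i $ i"
  have "0 \<le> v \<bullet> (A *v v)" for v
    using mult_nonneg_nonneg[OF a zero_le_square[of "v $ i"]] by (simp add: one_dim_matrix(3,6)[OF assms] mult_ac)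
  then show "psd_matrix A" using one_dim_matrix(7)[OF assms, of A] by (simp add: psd_matrix_def)
qed

lemma matrix_sqrt_one_dim:
  assumes U: "UNIV = {i::'n::finite}" and "0 \<le> (A::real^'n^'n) $ i $ i"
  shows "matrix_sqrt A = mat (sqrt (A $ i $ i))"
  unfolding matrix_sqrt_def
proof (rule the_equality)
  show "psd_matrix (mat (sqrt (A $ i $ i)) :: real^'n^'n) \<and> mat (sqrt (A $ i $ i)) ** mat (sqrt (A $ i $ i)) = A"
  proof
    show "psd_matrix (mat (sqrt (A $ i $ i)) :: real^'n^'n)"
      using assms(2) by (simp add: psd_matrix_one_dim[OF U] one_dim_matrix(2)[OF U])
    have "(mat (sqrt (A $ i $ i)) ** mat (sqrt (A $ i $ i)) :: real^'n^'n) $ i $ i = A $ i $ i"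
      using assms(2) by (simp add: one_dim_matrix(2,4)[OF U])
    then show "mat (sqrt (A $ i $ i)) ** mat (sqrt (A $ i $ i)) = A"
      using one_dim_matrix(1)[OF U] by metis
  qed
  fix R :: "real^'n^'n" assume R: "psd_matrix R \<and> R ** R = A"
  then have "0 \<le> R $ i $ i" "A $ i $ i = R $ i $ i * R $ i $ i"
    using one_dim_matrix(4)[OF U, of R R] psd_matrix_one_dim[OF U] by auto
  then show "R = mat (sqrt (A $ i $ i))"
    using one_dim_matrix(1)[OF U, of R] by simp
qed

text \<open>A negative entry admits no root, so the definite description there is that of an always
  false predicate, one fixed unspecified matrix for all such A. The map is therefore
  \<open>sqrt\<close> on one half-line and constant on the other.\<close>

lemma matrix_sqrt_measurable_one_dim:
  assumes U: "UNIV = {i::'n::finite}"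
  shows "(\<lambda>A::real^'n^'n. matrix_sqrt A $ i $ i) \<in> borel_measurable borel"
proof -
  have "matrix_sqrt A = (THE R. False)" if "\<not> 0 \<le> A $ i $ i" for A :: "real^'n^'n"
  proof -
    have "\<not> (psd_matrix R \<and> R ** R = A)" for R
      using one_dim_matrix(4)[OF U, of R R] that by auto
    then show ?thesis unfolding matrix_sqrt_def by (intro arg_cong[of _ _ The]) auto
  qed
  then have eq: "matrix_sqrt A $ i $ i = (if 0 \<le> A $ i $ i then sqrt (A $ i $ i) else (THE R::real^'n^'n. False) $ i $ i)"
    for A :: "real^'n^'n"
    by (auto simp: matrix_sqrt_one_dim[OF U] one_dim_matrix(2)[OF U])
  have [measurable]: "(\<lambda>A::real^'n^'n. A $ i $ i) \<in> borel_measurable borel"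
    by (intro borel_measurable_continuous_onI continuous_intros)
  show ?thesis unfolding eq by measurable
qed

lemma matrix_inv_one_dim:
  assumes U: "UNIV = {i::'n::finite}" and "s \<noteq> (0::real)"
  shows "matrix_inv (mat s :: real^'n^'n) $ i $ i = 1 / s"
proof -
  have "invertible (mat s :: real^'n^'n)"
    unfolding invertible_def using \<open>s \<noteq> 0\<close>
    by (intro exI[of _ "mat (1 / s)"]) (metis mult.commute nonzero_mult_div_cancel_left one_dim_matrix(1,2,4)[OF U] times_divide_eq_right mult_1_right)
  from matrix_inv_works(1)[OF this] have "(mat s ** matrix_inv (mat s) :: real^'n^'n) $ i $ i = 1"
    by (simp add: one_dim_matrix(2)[OF U])
  then show ?thesis using \<open>s \<noteq> 0\<close> by (simp add: one_dim_matrix(2,4)[OF U] field_simps)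
qed

text \<open>With a single coordinate, a level set is one point and a coordinate strip is a bounded
  box. The first is null by absolute continuity, the second has positive mass because the density is
  strictly positive and nonempty open sets are not negligible.\<close>

lemma mv_normal_one_dim_marginal:
  fixes \<Sigma> :: "real^'d^'d"
  assumes U: "UNIV = {i::'d}" and P: "prob_space (mv_normal \<Sigma>)"
  defines "\<nu> \<equiv> distr (mv_normal \<Sigma>) borel (\<lambda>z. z $ i)"
  shows "real_distribution \<nu>" "isCont (cdf \<nu>) x" "a < b \<Longrightarrow> cdf \<nu> a < cdf \<nu> b"
proof -
  interpret P: prob_space "mv_normal \<Sigma>" by fact
  have m: "(\<lambda>z. z $ i) \<in> borel_measurable (mv_normal \<Sigma>)" by measurable
  show R: "real_distribution \<nu>"
    unfolding \<nu>_def by (rule P.real_distribution_distr) measurable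
  interpret R: real_distribution \<nu> by fact
  show "isCont (cdf \<nu>) x"
  proof -
    have "{z::real^'d. z $ i = x} = {\<chi> _. x}" by (auto simp: vec_eq_iff all_index_one_dim[OF U])
    moreover have "emeasure (mv_normal \<Sigma>) {\<chi> _. x} = 0"
      unfolding mv_normal_eq by (rule absolutely_continuousD[OF absolutely_continuousI_density]) auto
    ultimately have "measure \<nu> {x} = 0"
      unfolding \<nu>_def by (subst measure_distr) (auto simp: vimage_def measure_def)
    then show ?thesis by (simp add: R.isCont_cdf)
  qed
  show "cdf \<nu> a < cdf \<nu> b" if "a < b"
  proof -
    have box: "{z::real^'d. a < z $ i \<and> z $ i < b} = box (\<chi> _. a) (\<chi> _. b)"
      by (auto simp: mem_box_cart all_index_one_dim[OF U])
    have "emeasure (mv_normal \<Sigma>) (box (\<chi> _. a) (\<chi> _. b)) \<noteq> 0"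
    proof
      assume "emeasure (mv_normal \<Sigma>) (box (\<chi> _. a) (\<chi> _. b)) = 0"
      then have "AE z in lborel. mvn_dens \<Sigma> z * indicator (box (\<chi> _. a) (\<chi> _. b)) z = 0"
        unfolding mv_normal_eq
        by (simp add: emeasure_density nn_integral_0_iff_AE ennreal_eq_0_iff mult_eq_0_iff indicator_def)
          (use mvn_dens_pos[OF P] in \<open>force simp: not_le[symmetric] elim: eventually_mono\<close>)
      then have "AE z in lborel. z \<notin> box (\<chi> _. a) (\<chi> _. b :: real^'d)"
        by eventually_elim (use mvn_dens_pos[OF P] in \<open>auto simp: indicator_def less_le split: if_splits\<close>)
      then have "emeasure lborel (box (\<chi> _. a) (\<chi> _. b) :: (real^'d) set) = 0"
        by (subst (asm) AE_iff_measurable[OF _ refl]) auto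
      then have "negligible (box (\<chi> _. a) (\<chi> _. b) :: (real^'d) set)"
        by (auto simp: negligible_iff_null_sets intro!: null_sets_completionI)
      moreover have "(\<chi> _. (a + b) / 2) \<in> box (\<chi> _. a) (\<chi> _. b :: real^'d)"
        using \<open>a < b\<close> by (simp add: mem_box_cart)
      ultimately show False using open_not_negligible[OF open_box] by blast
    qed
    then have "0 < measure (mv_normal \<Sigma>) {z::real^'d. a < z $ i \<and> z $ i < b}"
      unfolding box by (simp add: P.emeasure_eq_measure zero_less_measure_iff)
    also have "\<dots> \<le> measure (mv_normal \<Sigma>) {z::real^'d. a < z $ i \<and> z $ i \<le> b}"
    proof (rule P.finite_measure_mono)
      have "{z\<in>space (mv_normal \<Sigma>). a < z $ i \<and> z $ i \<le> b} \<in> sets (mv_normal \<Sigma>)" by measurable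
      then show "{z::real^'d. a < z $ i \<and> z $ i \<le> b} \<in> sets (mv_normal \<Sigma>)" by simp
    qed auto
    also have "\<dots> = measure \<nu> {a<..b}"
      unfolding \<nu>_def by (subst measure_distr) (auto simp: vimage_def)
    also have "\<dots> = cdf \<nu> b - cdf \<nu> a" using R.cdf_diff_eq[OF \<open>a < b\<close>] by simp
    finally show ?thesis by simp
  qed
qed

lemma (in real_distribution) cdf_quantile:
  assumes "\<And>x. isCont (cdf M) x" "0 < b" "b < 1"
  obtains q where "cdf M q = b"
proof -
  have "\<forall>\<^sub>F x in at_bot. cdf M x < b" "\<forall>\<^sub>F x in at_top. b < cdf M x"
    using order_tendstoD(2)[OF cdf_lim_at_bot \<open>0 < b\<close>] order_tendstoD(1)[OF cdf_lim_at_top_prob \<open>b < 1\<close>] by auto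
  then obtain l u where l: "\<And>x. x \<le> l \<Longrightarrow> cdf M x < b" and u: "\<And>x. x \<ge> u \<Longrightarrow> b < cdf M x"
    by (auto simp: eventually_at_bot_linorder eventually_at_top_linorder)
  \<comment> \<open>\<open>min l u\<close> orders the end points for the intermediate value theorem
    without comparing l and u.\<close>
  have "\<exists>x. min l u \<le> x \<and> x \<le> u \<and> cdf M x = b"
    using l[of "min l u"] u[of u] assms(1) by (intro IVT) auto
  then show ?thesis using that by auto
qed

text \<open>Continuous stand-in for the indicator of t \<le> x, falling linearly to 0 on [x, x + h];
  indicators themselves are not Lipschitz. Multiplication by h cancels its slope 1/h.\<close>

definition ramp :: "real \<Rightarrow> real \<Rightarrow> real \<Rightarrow> real" where
  "ramp h x t = max 0 (min 1 ((x + h - t) / h))"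

lemma ramp_bounds:
  assumes "0 < h"
  shows "0 \<le> ramp h x t" "ramp h x t \<le> 1" "t \<le> x \<Longrightarrow> ramp h x t = 1" "x + h \<le> t \<Longrightarrow> ramp h x t = 0"
  using assms by (auto simp: ramp_def divide_le_0_iff le_divide_eq min_def max_def)

lemma ramp_in_BL1:
  assumes "0 < h" "h \<le> 1"
  shows "(\<lambda>z::real^'d. h * ramp h x (z $ i)) \<in> BL1"
proof -
  have "1-lipschitz_on UNIV (\<lambda>z::real^'d. h * ramp h x (z $ i))"
  proof (rule lipschitz_onI)
    fix u v :: "real^'d"
    have eq: "h * ramp h x t = max 0 (min h (x + h - t))" for t
      using \<open>0 < h\<close> by (auto simp: ramp_def min_def max_def field_simps)
    have "\<bar>h * ramp h x (u $ i) - h * ramp h x (v $ i)\<bar> \<le> \<bar>u $ i - v $ i\<bar>"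
      unfolding eq by (auto simp: min_def max_def)
    also have "\<dots> \<le> dist u v" using component_le_norm_cart[of "u - v" i] by (simp add: dist_norm)
    finally show "dist (h * ramp h x (u $ i)) (h * ramp h x (v $ i)) \<le> 1 * dist u v" by (simp add: dist_real_def)
  qed simp
  moreover have "\<bar>h * ramp h x t\<bar> \<le> 1" for t
    using assms ramp_bounds[OF assms(1), of x t] by (simp add: abs_mult mult_le_one)
  ultimately show ?thesis by (auto simp: BL1_def)
qed

lemma ramp_integral:
  assumes "prob_space M" and [measurable]: "Y \<in> borel_measurable M" and "0 < h"
  shows "measure M {w\<in>space M. Y w \<le> x} \<le> (\<integral>w. ramp h x (Y w) \<partial>M)"
    and "(\<integral>w. ramp h x (Y w) \<partial>M) \<le> measure M {w\<in>space M. Y w \<le> x + h}"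
proof -
  interpret prob_space M by fact
  have [measurable]: "ramp h x \<in> borel_measurable borel" unfolding ramp_def by measurable
  have int: "integrable M (\<lambda>w. ramp h x (Y w))"
    by (rule integrable_const_bound[where B = 1]) (auto simp: ramp_bounds[OF \<open>0 < h\<close>])
  have ind: "integrable M (indicator {w\<in>space M. Y w \<le> y} :: _ \<Rightarrow> real)" for y
    by (rule integrable_const_bound[where B = 1]) auto
  have "measure M {w\<in>space M. Y w \<le> x} = (\<integral>w. indicator {w\<in>space M. Y w \<le> x} w \<partial>M)" by simp
  also have "\<dots> \<le> (\<integral>w. ramp h x (Y w) \<partial>M)"
    using ramp_bounds[OF \<open>0 < h\<close>] by (intro integral_mono int ind) (auto simp: indicator_def)
  finally show "measure M {w\<in>space M. Y w \<le> x} \<le> (\<integral>w. ramp h x (Y w) \<partial>M)" .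
  have "(\<integral>w. ramp h x (Y w) \<partial>M) \<le> (\<integral>w. indicator {w\<in>space M. Y w \<le> x + h} w \<partial>M)"
    using ramp_bounds[OF \<open>0 < h\<close>] by (intro integral_mono int ind) (auto simp: indicator_def)
  also have "\<dots> = measure M {w\<in>space M. Y w \<le> x + h}" by simp
  finally show "(\<integral>w. ramp h x (Y w) \<partial>M) \<le> measure M {w\<in>space M. Y w \<le> x + h}" .
qed

text \<open>If the conditional quantile fell below q - e, the conditional distribution function
  would already reach b there, and the ramp would carry this over to the limit law at q - e/2,
  against its strict increase; the other side is symmetric. The argument runs sample by sample on
  the event where the quantile equation holds.\<close>

lemma conditional_quantile_conv:
  fixes T :: "nat \<Rightarrow> 'a \<Rightarrow> 'w \<Rightarrow> real^'d" and \<mu> :: "(real^'d) measure"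
  assumes MW: "prob_space MW" and mu: "prob_space \<mu>" and [measurable_cong]: "sets \<mu> = sets borel"
    and T: "\<And>n x. x \<in> space MX \<Longrightarrow> T n x \<in> borel_measurable MW"
    and weak: "cond_conv_in_distr MX MW T \<mu>"
    and quant: "(\<lambda>n. outer_measure_of MX {x\<in>space MX. measure MW {w\<in>space MW. T n x w $ i \<le> y n x} \<noteq> b}) \<longlonglongrightarrow> 0"
    and q: "cdf (distr \<mu> borel (\<lambda>z. z $ i)) q = b"
    and strict: "\<And>x y. x < y \<Longrightarrow> cdf (distr \<mu> borel (\<lambda>z. z $ i)) x < cdf (distr \<mu> borel (\<lambda>z. z $ i)) y"
  shows "conv_in_prob MX y q"
  unfolding conv_in_prob_def
proof (intro allI impI)
  fix e :: real assume "0 < e"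
  define G where "G = cdf (distr \<mu> borel (\<lambda>z. z $ i))"
  have G: "G x = measure \<mu> {z\<in>space \<mu>. z $ i \<le> x}" for x
    unfolding G_def cdf_def by (subst measure_distr) (auto intro!: arg_cong[of _ _ "measure \<mu>"])
  \<comment> \<open>A ramp width of at most e/2 keeps the smeared level within the margin e/2 of q;
    width at most 1 is needed for \<open>BL1\<close>.\<close>
  define h where "h = min (e / 2) 1"
  have h: "0 < h" "h \<le> 1" "h \<le> e / 2" using \<open>0 < e\<close> by (auto simp: h_def)
  \<comment> \<open>The scaled ramp is a \<open>BL1\<close> function, so a distance r costs r/h in
    probability, which is half of the smaller gap of \<open>G\<close> around b.\<close>
  define r where "r = h * min (b - G (q - e / 2)) (G (q + e / 2) - b) / 2"
  have gap: "G (q - e / 2) < b" "b < G (q + e / 2)"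
    using strict[of "q - e / 2" q] strict[of q "q + e / 2"] q \<open>0 < e\<close> by (auto simp: G_def)
  then have "0 < r" using h by (simp add: r_def)
  have Gmono: "G x \<le> G y" if "x \<le> y" for x y
    using strict[of x y] that by (cases "x = y") (auto simp: G_def)
  have close: "\<bar>(\<integral>w. ramp h z (T n x w $ i) \<partial>MW) - (\<integral>v. ramp h z (v $ i) \<partial>\<mu>)\<bar> \<le> BL_dist MW (T n x) \<mu> / h" for n x z
    using BL_dist_upper[OF MW mu ramp_in_BL1[OF h(1,2), of z i], of "T n x"] h(1)
    by (simp add: right_diff_distrib[symmetric] abs_mult le_divide_eq mult.commute)
  show "(\<lambda>n. outer_measure_of MX {x\<in>space MX. e < dist (y n x) q}) \<longlonglongrightarrow> 0"
  proof (rule outer_measure_null_Un[OF quant cond_conv_in_distr_BL_dist[OF weak \<open>0 < r\<close>]],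
      intro always_eventually allI subsetI, rule ccontr)
    fix n x assume x: "x \<in> {x\<in>space MX. e < dist (y n x) q}"
      and "x \<notin> {x\<in>space MX. measure MW {w\<in>space MW. T n x w $ i \<le> y n x} \<noteq> b} \<union> {x\<in>space MX. r < BL_dist MW (T n x) \<mu>}"
    then have b: "measure MW {w\<in>space MW. T n x w $ i \<le> y n x} = b" and D: "BL_dist MW (T n x) \<mu> \<le> r" by auto
    interpret W: prob_space MW by fact
    have [measurable]: "T n x \<in> borel_measurable MW" using T x by simp
    have mi: "(\<lambda>w. T n x w $ i) \<in> borel_measurable MW" "(\<lambda>v. v $ i) \<in> borel_measurable \<mu>" by measurable
    have mono: "measure MW {w\<in>space MW. T n x w $ i \<le> s} \<le> measure MW {w\<in>space MW. T n x w $ i \<le> t}" if "s \<le> t" for s t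
      using that by (intro W.finite_measure_mono) auto
    have Dh: "BL_dist MW (T n x) \<mu> / h \<le> r / h" using D h by (simp add: divide_right_mono)
    have rh: "r / h < b - G (q - e / 2)" "r / h < G (q + e / 2) - b"
      using gap h by (auto simp: r_def min_def)
    consider "y n x < q - e" | "q + e < y n x" using x by (auto simp: dist_real_def abs_if split: if_splits)
    then show False
    proof cases
      case 1
      have "b \<le> measure MW {w\<in>space MW. T n x w $ i \<le> q - e}" using mono[of "y n x" "q - e"] 1 b by simp
      also have "\<dots> \<le> (\<integral>w. ramp h (q - e) (T n x w $ i) \<partial>MW)" by (rule ramp_integral[OF MW mi(1) h(1)])
      also have "\<dots> \<le> (\<integral>v. ramp h (q - e) (v $ i) \<partial>\<mu>) + r / h" using close[of "q - e" n x] Dh by linarith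
      also have "(\<integral>v. ramp h (q - e) (v $ i) \<partial>\<mu>) \<le> G (q - e + h)" unfolding G by (rule ramp_integral[OF mu mi(2) h(1)])
      also have "\<dots> \<le> G (q - e / 2)" using h by (intro Gmono) (simp add: field_simps)
      finally show False using rh by simp
    next
      case 2
      have "G (q + e / 2) \<le> G (q + e - h)" using h by (intro Gmono) (simp add: field_simps)
      also have "\<dots> \<le> (\<integral>v. ramp h (q + e - h) (v $ i) \<partial>\<mu>)" unfolding G by (rule ramp_integral[OF mu mi(2) h(1)])
      also have "\<dots> \<le> (\<integral>w. ramp h (q + e - h) (T n x w $ i) \<partial>MW) + r / h" using close[of "q + e - h" n x] Dh by linarith
      also have "(\<integral>w. ramp h (q + e - h) (T n x w $ i) \<partial>MW) \<le> measure MW {w\<in>space MW. T n x w $ i \<le> q + e}"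
        using ramp_integral(2)[OF MW mi(1) h(1), of "q + e - h"] by simp
      also have "\<dots> \<le> b" using mono[of "q + e" "y n x"] 2 b by simp
      finally show False using rh by simp
    qed
  qed
qed

text \<open>Since the end points have constant limits, no joint law is involved: outside an event of
  vanishing probability they lie within s of a and b, which sandwiches the coverage between
  distribution function increments of \<open>S n\<close> on fixed intervals. Continuity of the limit
  then lets s shrink.\<close>

lemma random_interval_coverage:
  fixes S lo up :: "nat \<Rightarrow> 'a \<Rightarrow> real"
  assumes "prob_space M"
    and [measurable]: "\<And>n. S n \<in> borel_measurable M" "\<And>n. lo n \<in> borel_measurable M" "\<And>n. up n \<in> borel_measurable M"
    and S: "weak_conv_m (\<lambda>n. distr M borel (S n)) \<nu>" and cont: "\<And>x. isCont (cdf \<nu>) x"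
    and lo: "conv_in_prob M lo a" and up: "conv_in_prob M up b" and "a < b"
  shows "(\<lambda>n. measure M {x\<in>space M. lo n x \<le> S n x \<and> S n x \<le> up n x}) \<longlonglongrightarrow> cdf \<nu> b - cdf \<nu> a"
proof -
  interpret prob_space M by fact
  define F where "F n = cdf (distr M borel (S n))" for n
  have F: "(\<lambda>n. F n x) \<longlonglongrightarrow> cdf \<nu> x" for x
    using S cont by (simp add: weak_conv_m_def weak_conv_def F_def)
  have Fdiff: "F n y - F n x = measure M {z\<in>space M. x < S n z \<and> S n z \<le> y}" if "x < y" for n x y
  proof -
    interpret R: real_distribution "distr M borel (S n)" by (rule real_distribution_distr) simp
    show ?thesis unfolding F_def R.cdf_diff_eq[OF that]
      by (subst measure_distr) (auto intro!: arg_cong[of _ _ "measure M"])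
  qed
  define A where "A n = {x\<in>space M. lo n x \<le> S n x \<and> S n x \<le> up n x}" for n
  define Bad where "Bad n s = measure M {x\<in>space M. s < dist (lo n x) a} + measure M {x\<in>space M. s < dist (up n x) b}" for n s
  have Bad: "(\<lambda>n. Bad n s) \<longlonglongrightarrow> 0" if "0 < s" for s
  proof -
    have null: "(\<lambda>n. measure M {x\<in>space M. s < dist (Y n x) l}) \<longlonglongrightarrow> 0"
      if "conv_in_prob M Y l" and [measurable]: "\<And>n. Y n \<in> borel_measurable M" for Y and l :: real
    proof -
      have "(\<lambda>n. emeasure M {x\<in>space M. s < dist (Y n x) l}) \<longlonglongrightarrow> 0"
        using conv_in_probD[OF that(1) \<open>0 < s\<close>] by simp
      then have "(\<lambda>n. ennreal (measure M {x\<in>space M. s < dist (Y n x) l})) \<longlonglongrightarrow> ennreal 0"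
        by (simp add: emeasure_eq_measure)
      then show ?thesis by (subst (asm) tendsto_ennreal_iff) auto
    qed
    show ?thesis unfolding Bad_def using tendsto_add[OF null[OF lo] null[OF up]] by simp
  qed
  \<comment> \<open>Increments of a distribution function describe left-open intervals, while the
    random interval is closed; \<open>2 * s\<close> instead of \<open>s\<close> on the left makes
    the inequality strict.\<close>
  have upper: "measure M (A n) \<le> F n (b + s) - F n (a - 2 * s) + Bad n s" if "0 < s" for n s
  proof -
    have "measure M (A n) \<le> measure M ({x\<in>space M. a - 2 * s < S n x \<and> S n x \<le> b + s} \<union>
        ({x\<in>space M. s < dist (lo n x) a} \<union> {x\<in>space M. s < dist (up n x) b}))"
      using that by (intro finite_measure_mono) (auto simp: A_def dist_real_def)
    also have "\<dots> \<le> measure M {x\<in>space M. a - 2 * s < S n x \<and> S n x \<le> b + s} + Bad n s"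
      unfolding Bad_def by (intro order_trans[OF measure_Un_le] add_mono measure_Un_le) auto
    finally show ?thesis using \<open>a < b\<close> that by (simp add: Fdiff)
  qed
  have lower: "F n (b - s) - F n (a + s) - Bad n s \<le> measure M (A n)" if "0 < s" "a + s < b - s" for n s
  proof -
    have "measure M {x\<in>space M. a + s < S n x \<and> S n x \<le> b - s} \<le> measure M (A n \<union>
        ({x\<in>space M. s < dist (lo n x) a} \<union> {x\<in>space M. s < dist (up n x) b}))"
      using that by (intro finite_measure_mono) (auto simp: A_def dist_real_def)
    also have "\<dots> \<le> measure M (A n) + Bad n s"
      unfolding Bad_def by (intro order_trans[OF measure_Un_le] add_mono measure_Un_le) (auto simp: A_def)
    finally show ?thesis using that by (simp add: Fdiff)
  qed
  have "(\<lambda>n. measure M (A n)) \<longlonglongrightarrow> cdf \<nu> b - cdf \<nu> a"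
  proof (rule tendstoI)
    fix e :: real assume "0 < e"
    have "((\<lambda>s. cdf \<nu> (b + s) - cdf \<nu> (a - 2 * s)) \<longlongrightarrow> cdf \<nu> (b + 0) - cdf \<nu> (a - 2 * 0)) (at_right 0)"
      "((\<lambda>s. cdf \<nu> (b - s) - cdf \<nu> (a + s)) \<longlongrightarrow> cdf \<nu> (b - 0) - cdf \<nu> (a + 0)) (at_right 0)"
      by (intro tendsto_intros isCont_tendsto_compose[OF cont])+
    from tendstoD[OF this(1), of "e / 2"] tendstoD[OF this(2), of "e / 2"]
    have "\<forall>\<^sub>F s in at_right 0. dist (cdf \<nu> (b + s) - cdf \<nu> (a - 2 * s)) (cdf \<nu> b - cdf \<nu> a) < e / 2 \<and>
      dist (cdf \<nu> (b - s) - cdf \<nu> (a + s)) (cdf \<nu> b - cdf \<nu> a) < e / 2 \<and> 0 < s \<and> s < (b - a) / 2"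
      using \<open>0 < e\<close> \<open>a < b\<close> eventually_at_right_less[of "0::real"] eventually_at_right_real[of 0 "(b - a) / 2"]
      by (auto simp: eventually_conj_iff elim: eventually_mono)
    then obtain s where s: "dist (cdf \<nu> (b + s) - cdf \<nu> (a - 2 * s)) (cdf \<nu> b - cdf \<nu> a) < e / 2"
      "dist (cdf \<nu> (b - s) - cdf \<nu> (a + s)) (cdf \<nu> b - cdf \<nu> a) < e / 2" "0 < s" "s < (b - a) / 2"
      using eventually_happens'[OF trivial_limit_at_right_real] by blast
    have "(\<lambda>n. F n (b + s) - F n (a - 2 * s) + Bad n s) \<longlonglongrightarrow> cdf \<nu> (b + s) - cdf \<nu> (a - 2 * s) + 0"
      "(\<lambda>n. F n (b - s) - F n (a + s) - Bad n s) \<longlonglongrightarrow> cdf \<nu> (b - s) - cdf \<nu> (a + s) - 0"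
      by (intro tendsto_intros F Bad \<open>0 < s\<close>)+
    then have "\<forall>\<^sub>F n in sequentially. dist (F n (b + s) - F n (a - 2 * s) + Bad n s) (cdf \<nu> (b + s) - cdf \<nu> (a - 2 * s)) < e / 2"
      "\<forall>\<^sub>F n in sequentially. dist (F n (b - s) - F n (a + s) - Bad n s) (cdf \<nu> (b - s) - cdf \<nu> (a + s)) < e / 2"
      using \<open>0 < e\<close> by (auto dest!: tendstoD[of _ _ _ "e / 2"])
    then show "\<forall>\<^sub>F n in sequentially. dist (measure M (A n)) (cdf \<nu> b - cdf \<nu> a) < e"
    proof eventually_elim
      case n: (elim n)
      have "a + s < b - s" using s(4) by (simp add: field_simps)
      with upper[OF s(3), of n] lower[OF s(3), of n] n s(1,2)
      show ?case
        unfolding dist_real_def abs_less_iff by linarith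
    qed
  qed
  then show ?thesis by (simp add: A_def)
qed

text \<open>Coverage is asserted for \<open>CARD('d) = 1\<close>. For several coordinates the mass
  of the box between lo and up is not the difference of the masses below up and below lo, and
  quantile vectors are not unique: taking one coordinate of both very large leaves the quantile
  equations solvable while the box carries almost no mass.\<close>

theorem corollary1:
  fixes MX :: "'a measure" and PX :: "'x measure" and X :: "nat \<Rightarrow> 'a \<Rightarrow> 'x"
    and MW :: "'w measure" and W :: "nat \<Rightarrow> nat \<Rightarrow> 'w \<Rightarrow> real" and c :: real
    and \<Theta> :: "(real^'d) set" and H :: "'h set" and d :: "'h \<Rightarrow> 'h \<Rightarrow> real"
    and m :: "real^'d \<Rightarrow> 'h \<Rightarrow> 'x \<Rightarrow> real"
    and \<theta>0 :: "real^'d" and \<eta>0 :: 'h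
    and th :: "nat \<Rightarrow> (nat \<Rightarrow> 'x) \<Rightarrow> real^'d" and et :: "nat \<Rightarrow> (nat \<Rightarrow> 'x) \<Rightarrow> 'h"
    and thb :: "nat \<Rightarrow> (nat \<Rightarrow> 'x) \<Rightarrow> (nat \<Rightarrow> real) \<Rightarrow> real^'d"
    and etb :: "nat \<Rightarrow> (nat \<Rightarrow> 'x) \<Rightarrow> (nat \<Rightarrow> real) \<Rightarrow> 'h"
    and \<Sigma> :: "real^'d^'d" and Sh :: "nat \<Rightarrow> (nat \<Rightarrow> 'x) \<Rightarrow> real^'d^'d"
  assumes "prob_space MX" and "prob_space PX" and "prob_space MW"
    and "iid_data MX PX X"
    and "\<And>n i. i < n \<Longrightarrow> W n i \<in> borel_measurable MW"
    and "Metric_space H d"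
    and "\<And>\<theta> \<eta>. \<theta> \<in> \<Theta> \<Longrightarrow> \<eta> \<in> H \<Longrightarrow> integrable PX (m \<theta> \<eta>)"
    and "is_argsup (\<lambda>f. \<integral>x. f x \<partial>PX) m \<Theta> H \<theta>0 \<eta>0"
    and th_meas: "\<And>n. th n \<in> borel_measurable (\<Pi>\<^sub>M i\<in>{..<n}. PX)"
    and thb_meas: "\<And>n. (\<lambda>(xs, ws). thb n xs ws)
          \<in> borel_measurable ((\<Pi>\<^sub>M i\<in>{..<n}. PX) \<Otimes>\<^sub>M (\<Pi>\<^sub>M i\<in>{..<n}. borel))"
    and estimator: "\<And>n. 1 \<le> n \<Longrightarrow> AE x in MX.
          is_argsup (emp n (obs X n x)) m \<Theta> H (th n (obs X n x)) (et n (obs X n x))"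
    and boot_estimator: "\<And>n. 1 \<le> n \<Longrightarrow> AE (x, w) in MX \<Otimes>\<^sub>M MW.
          is_argsup (boot_emp n (obs X n x) (wvec W n w)) m \<Theta> H
            (thb n (obs X n x) (wvec W n w)) (etb n (obs X n x) (wvec W n w))"
    and "weights_W1 MW W" and "weights_W2 MW W" and "weights_W3 MW W" and "weights_W4 MW W"
    and "0 < c" and "weights_W5 MW W c"
    and M1: "\<exists>K>0. \<forall>\<theta>\<in>\<Theta>. \<forall>\<eta>\<in>H.
          (\<integral>x. m \<theta> \<eta> x - m \<theta>0 \<eta>0 x \<partial>PX) \<le> - K * ((norm (\<theta> - \<theta>0))\<^sup>2 + (d \<eta> \<eta>0)\<^sup>2)"
    and M2: "\<exists>p>2. \<exists>C. \<forall>\<delta>>0. \<forall>n\<ge>1.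
          outer_Lp_norm MX p (\<lambda>x. sup_over (emp_process PX n (obs X n x))
              (increment_class m \<Theta> H d \<theta>0 \<eta>0 \<delta>)) \<le> ennreal (C * \<delta>) \<and>
          outer_Lp_norm (MX \<Otimes>\<^sub>M MW) p (\<lambda>(x, w). sup_over (boot_process n (obs X n x) (wvec W n w))
              (increment_class m \<Theta> H d \<theta>0 \<eta>0 \<delta>)) \<le> ennreal (C * \<delta>)"
    and M3: "bigO_in_prob MX (\<lambda>n x. d (et n (obs X n x)) \<eta>0) (\<lambda>n. 1 / sqrt (real n))"
    and M3_boot: "bigO_in_prob (MX \<Otimes>\<^sub>M MW)
          (\<lambda>n (x, w). d (etb n (obs X n x) (wvec W n w)) \<eta>0) (\<lambda>n. 1 / sqrt (real n))"
    and "psd_matrix \<Sigma>" and "invertible \<Sigma>"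
    and weak: "conv_in_distr MX (\<lambda>n x. sqrt (real n) *\<^sub>R (th n (obs X n x) - \<theta>0)) (mv_normal \<Sigma>)"
    and boot_weak: "cond_conv_in_distr MX MW
          (\<lambda>n x w. (sqrt (real n) / c) *\<^sub>R (thb n (obs X n x) (wvec W n w) - th n (obs X n x)))
          (mv_normal \<Sigma>)"
    and Sh_meas: "\<And>n. Sh n \<in> borel_measurable (\<Pi>\<^sub>M i\<in>{..<n}. PX)"
    and consistent: "conv_in_prob MX (\<lambda>n x. Sh n (obs X n x)) \<Sigma>"
  shows "conv_in_prob MX (\<lambda>n x. boot_variance MW W c th thb n (obs X n x)) \<Sigma> \<and>
    (CARD('d) = 1 \<longrightarrow>
      (\<forall>\<alpha> lo up.
         0 < \<alpha> \<and> \<alpha> < 1 \<and>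
         (\<forall>n. lo n \<in> borel_measurable (\<Pi>\<^sub>M i\<in>{..<n}. PX)) \<and>
         (\<forall>n. up n \<in> borel_measurable (\<Pi>\<^sub>M i\<in>{..<n}. PX)) \<and>
         boot_quantile MX X MW W c th thb (\<alpha> / 2) lo \<and>
         boot_quantile MX X MW W c th thb (1 - \<alpha> / 2) up \<longrightarrow>
         (\<lambda>n. measure (MX \<Otimes>\<^sub>M MW) {(x, w). x \<in> space MX \<and> w \<in> space MW \<and>
                 \<theta>0 \<in> BC_t th Sh lo up n (obs X n x)}) \<longlonglongrightarrow> 1 - \<alpha>))"
proof -
  note MX = assms(1) and MW = assms(3) and iid = assms(4) and W = assms(5)
  interpret X: prob_space MX by fact
  interpret W: prob_space MW by fact
  let ?\<mu> = "mv_normal \<Sigma>"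
  have center: "\<theta>0 \<in> \<Theta>" "\<eta>0 \<in> H"
    using assms(8) by (auto simp: is_argsup_def is_arg_max_def)
  have sym: "transpose \<Sigma> = \<Sigma>" using \<open>psd_matrix \<Sigma>\<close> by (simp add: psd_matrix_def)
  \<comment> \<open>Weak convergence tested with the constant 1 equates the mass of the limit with
    that of the probability space \<open>MX\<close>.\<close>
  have mu: "prob_space ?\<mu>"
  proof (rule prob_space_mv_normal)
    have "(\<lambda>n. \<integral>x. 1 \<partial>MX) \<longlonglongrightarrow> (\<integral>y. 1 \<partial>?\<mu> :: real)"
      using weak[unfolded conv_in_distr_def, rule_format, of "\<lambda>_. 1"] by simp
    then show "measure ?\<mu> UNIV = 1"
      by (simp add: X.prob_space LIMSEQ_const_iff)
  qed
  note [measurable] = obs_measurable[OF MX iid] wvec_measurable[of W, OF W]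
  have th[measurable]: "(\<lambda>x. th n (obs X n x)) \<in> borel_measurable MX" for n
    using measurable_compose[OF obs_measurable[OF MX iid] th_meas] .
  have thb[measurable]: "(\<lambda>z. thb n (obs X n (fst z)) (wvec W n (snd z))) \<in> borel_measurable (MX \<Otimes>\<^sub>M MW)" for n
    using measurable_compose[OF _ thb_meas[of n], of "\<lambda>z. (obs X n (fst z), wvec W n (snd z))" "MX \<Otimes>\<^sub>M MW"] by simp
  define T where "T n x w = (sqrt (real n) / c) *\<^sub>R (thb n (obs X n x) (wvec W n w) - th n (obs X n x))" for n x w
  have T_meas: "(\<lambda>(x, w). T n x w) \<in> borel_measurable (MX \<Otimes>\<^sub>M MW)" for n
    unfolding T_def case_prod_beta by measurable
  have T_meas': "T n x \<in> borel_measurable MW" if "x \<in> space MX" for n x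
    using measurable_Pair2[OF T_meas[of n], of x] that by simp
  obtain p B where p: "2 < p" "0 \<le> B"
    and th_tail: "\<And>n t. 1 \<le> n \<Longrightarrow> 0 < t \<Longrightarrow>
      emeasure MX {x\<in>space MX. t < sqrt (real n) * norm (th n (obs X n x) - \<theta>0)} \<le> ennreal (B * t powr - p)"
    and thb_tail: "\<And>n t. 1 \<le> n \<Longrightarrow> 0 < t \<Longrightarrow>
      emeasure (MX \<Otimes>\<^sub>M MW) {z\<in>space (MX \<Otimes>\<^sub>M MW).
        t < sqrt (real n) * norm (thb n (obs X n (fst z)) (wvec W n (snd z)) - \<theta>0)} \<le> ennreal (B * t powr - p)"
    by (rule estimator_tails[OF MX MW iid W center th_meas thb_meas estimator boot_estimator M1 M2]) (assumption | blast)+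

  \<comment> \<open>Uniform tail of the scaled bootstrap error\<close>
  have T_tail: "emeasure (MX \<Otimes>\<^sub>M MW) {z\<in>space (MX \<Otimes>\<^sub>M MW). t < norm (case z of (x, w) \<Rightarrow> T n x w)}
      \<le> ennreal (2 * B * (c / 2) powr - p * t powr - p)" if n: "1 \<le> n" and t: "0 < t" for n t
  proof -
    \<comment> \<open>If both estimators, centred at \<open>\<theta>0\<close> and scaled by root n,
      stay below s, the triangle inequality gives norm at most 2 s / c = t.\<close>
    define s where "s = c / 2 * t"
    have "0 < s" using t \<open>0 < c\<close> by (simp add: s_def)
    let ?A = "{x\<in>space MX. s < sqrt (real n) * norm (th n (obs X n x) - \<theta>0)}"
    let ?B = "{z\<in>space (MX \<Otimes>\<^sub>M MW). s < sqrt (real n) * norm (thb n (obs X n (fst z)) (wvec W n (snd z)) - \<theta>0)}"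
    have "{z\<in>space (MX \<Otimes>\<^sub>M MW). t < norm (case z of (x, w) \<Rightarrow> T n x w)} \<subseteq> ?A \<times> space MW \<union> ?B"
    proof (intro subsetI, rule ccontr)
      fix z assume z: "z \<in> {z\<in>space (MX \<Otimes>\<^sub>M MW). t < norm (case z of (x, w) \<Rightarrow> T n x w)}"
        and nz: "z \<notin> ?A \<times> space MW \<union> ?B"
      obtain x w where xw: "z = (x, w)" by (cases z)
      let ?a = "th n (obs X n x) - \<theta>0" and ?b = "thb n (obs X n x) (wvec W n w) - \<theta>0"
      have le: "sqrt (real n) * norm ?a \<le> s" "sqrt (real n) * norm ?b \<le> s"
        using z nz by (auto simp: xw space_pair_measure)
      have "norm (T n x w) = sqrt (real n) / c * norm (?b - ?a)"
        using \<open>0 < c\<close> by (simp add: T_def)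
      also have "\<dots> \<le> sqrt (real n) / c * (norm ?b + norm ?a)"
        using \<open>0 < c\<close> by (intro mult_left_mono norm_triangle_ineq4) auto
      also have "\<dots> = (sqrt (real n) * norm ?b + sqrt (real n) * norm ?a) / c"
        by (simp add: distrib_left add_divide_distrib)
      also have "\<dots> \<le> (s + s) / c" using le \<open>0 < c\<close> by (intro divide_right_mono add_mono) auto
      also have "\<dots> = t" using \<open>0 < c\<close> by (simp add: s_def)
      finally show False using z by (simp add: xw)
    qed
    then have "emeasure (MX \<Otimes>\<^sub>M MW) {z\<in>space (MX \<Otimes>\<^sub>M MW). t < norm (case z of (x, w) \<Rightarrow> T n x w)}
        \<le> emeasure (MX \<Otimes>\<^sub>M MW) (?A \<times> space MW \<union> ?B)" by (rule emeasure_mono) measurable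
    also have "\<dots> \<le> emeasure (MX \<Otimes>\<^sub>M MW) (?A \<times> space MW) + emeasure (MX \<Otimes>\<^sub>M MW) ?B"
      by (rule emeasure_subadditive) measurable
    also have "emeasure (MX \<Otimes>\<^sub>M MW) (?A \<times> space MW) = emeasure MX ?A"
      by (simp add: W.emeasure_pair_measure_Times W.emeasure_space_1)
    also have "emeasure MX ?A + emeasure (MX \<Otimes>\<^sub>M MW) ?B \<le> ennreal (B * s powr - p) + ennreal (B * s powr - p)"
      by (intro add_mono th_tail thb_tail n \<open>0 < s\<close>)
    also have "\<dots> = ennreal (2 * B * (c / 2) powr - p * t powr - p)"
    proof -
      have "s powr - p = (c / 2) powr - p * t powr - p"
        unfolding s_def using t \<open>0 < c\<close> by (intro powr_mult)
      then show ?thesis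
        using \<open>0 \<le> B\<close> by (simp add: ennreal_plus[symmetric] mult.assoc del: ennreal_plus)
    qed
    finally show ?thesis .
  qed

  \<comment> \<open>Consistency of the bootstrap variance\<close>
  have var: "boot_variance MW W c th thb n (obs X n x) = (\<integral>w. outer_prod (T n x w) \<partial>MW)" for n x
    using \<open>0 < c\<close> by (simp add: boot_variance_def T_def outer_prod_scaleR bochner_scaleR_right power_divide)
  have conv: "conv_in_prob MX (\<lambda>n x. boot_variance MW W c th thb n (obs X n x)) \<Sigma>"
    unfolding var
  proof (rule conditional_second_moment_conv[OF MX MW mu _ T_meas p(1) _ T_tail])
    show "cond_conv_in_distr MX MW T ?\<mu>" using boot_weak unfolding T_def[abs_def] .
    show "has_bochner_integral ?\<mu> (\<lambda>z. z $ i * z $ j) (\<Sigma> $ i $ j)" for i j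
      by (rule mv_normal_second_moment[OF \<open>invertible \<Sigma>\<close> sym mu])
  qed (use p in auto)

  \<comment> \<open>Coverage in dimension one\<close>
  have "(\<lambda>n. measure (MX \<Otimes>\<^sub>M MW) {(x, w). x \<in> space MX \<and> w \<in> space MW \<and>
      \<theta>0 \<in> BC_t th Sh lo up n (obs X n x)}) \<longlonglongrightarrow> 1 - \<alpha>"
    if card: "CARD('d) = 1" and \<alpha>: "0 < \<alpha>" "\<alpha> < 1"
      and lo_meas: "\<And>n. lo n \<in> borel_measurable (\<Pi>\<^sub>M i\<in>{..<n}. PX)"
      and up_meas: "\<And>n. up n \<in> borel_measurable (\<Pi>\<^sub>M i\<in>{..<n}. PX)"
      and lo: "boot_quantile MX X MW W c th thb (\<alpha> / 2) lo"
      and up: "boot_quantile MX X MW W c th thb (1 - \<alpha> / 2) up" for \<alpha> lo up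
  proof -
    obtain i :: 'd where U: "UNIV = {i}" using card by (rule card_1_singletonE)
    note dim1 = one_dim_matrix[OF U]
    define v where "v = \<Sigma> $ i $ i"
    have "0 < v"
    proof -
      have "0 \<le> v" using \<open>psd_matrix \<Sigma>\<close> psd_matrix_one_dim[OF U] by (simp add: v_def)
      moreover have "v * matrix_inv \<Sigma> $ i $ i = 1"
        using dim1(4)[of \<Sigma> "matrix_inv \<Sigma>"] matrix_inv_works(1)[OF \<open>invertible \<Sigma>\<close>] dim1(2)[of 1]
        by (simp add: v_def)
      ultimately show ?thesis by (cases "v = 0") auto
    qed
    define \<nu> where "\<nu> = distr ?\<mu> borel (\<lambda>z. z $ i)"
    note nu = mv_normal_one_dim_marginal[OF U mu, folded \<nu>_def]
    interpret nu: real_distribution \<nu> by (rule nu)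
    define V where "V n x = boot_variance MW W c th thb n (obs X n x) $ i $ i" for n x
    define s where "s n x = Sh n (obs X n x) $ i $ i" for n x
    have comp: "isCont (\<lambda>A::real^'d^'d. A $ i $ i) \<Sigma>"
      by (intro continuous_intros)
    have V: "conv_in_prob MX V v" and s: "conv_in_prob MX s v"
      using conv_in_prob_isCont[OF conv comp] conv_in_prob_isCont[OF consistent comp]
      unfolding V_def[abs_def] s_def[abs_def] v_def by auto
    \<comment> \<open>A variance entry converging to v > 0 is nonpositive with vanishing outer
      probability; this is the event where \<open>matrix_sqrt\<close> or \<open>matrix_inv\<close>
      may take unspecified values.\<close>
    have nonpos: "(\<lambda>n. outer_measure_of MX {x\<in>space MX. Y n x \<le> 0}) \<longlonglongrightarrow> 0" if "conv_in_prob MX Y v" for Y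
    proof -
      have "0 < v / 2" using \<open>0 < v\<close> by simp
      from conv_in_probD[OF that this] show ?thesis
        by (rule outer_measure_null_subset) (use \<open>0 < v\<close> in \<open>auto simp: dist_real_def intro!: always_eventually\<close>)
    qed
    have quantile: "conv_in_prob MX (\<lambda>n x. matrix_sqrt (Sh n (obs X n x)) $ i $ i * r n (obs X n x) $ i) q"
      if r: "boot_quantile MX X MW W c th thb b r" and q: "cdf \<nu> q = b" for r b q
    proof -
      have "conv_in_prob MX (\<lambda>n x. sqrt (V n x) * r n (obs X n x) $ i) q"
      proof (rule conditional_quantile_conv[OF MW mu _ T_meas', where i = i and b = b])
        show "cond_conv_in_distr MX MW T ?\<mu>" using boot_weak unfolding T_def[abs_def] .
        \<comment> \<open>Multiplying by the positive \<open>sqrt (V n x)\<close> removes the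
          studentisation, so the rescaled quantile is a quantile of \<open>T\<close>, whose
          conditional limit is known.\<close>
        have eq: "{w\<in>space MW. T n x w $ i \<le> sqrt (V n x) * r n (obs X n x) $ i}
            = {w\<in>space MW. boot_t_stat MW W c th thb n (obs X n x) (wvec W n w) \<le> r n (obs X n x)}"
          if "0 < V n x" for n x
        proof -
          have "matrix_inv (matrix_sqrt (boot_variance MW W c th thb n (obs X n x))) $ i $ i = 1 / sqrt (V n x)"
            using that by (simp add: matrix_sqrt_one_dim[OF U] matrix_inv_one_dim[OF U] V_def)
          then have "boot_t_stat MW W c th thb n (obs X n x) (wvec W n w) $ i = T n x w $ i / sqrt (V n x)" for w
            by (simp add: boot_t_stat_def dim1(3) T_def)
          then show ?thesis using that by (simp add: dim1(5) divide_le_eq mult.commute)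
        qed
        show "(\<lambda>n. outer_measure_of MX {x\<in>space MX.
            measure MW {w\<in>space MW. T n x w $ i \<le> sqrt (V n x) * r n (obs X n x) $ i} \<noteq> b}) \<longlonglongrightarrow> 0"
        proof (rule outer_measure_null_Un[OF r[unfolded boot_quantile_def] nonpos[OF V]],
            intro always_eventually allI subsetI)
          fix n x assume "x \<in> {x\<in>space MX.
            measure MW {w\<in>space MW. T n x w $ i \<le> sqrt (V n x) * r n (obs X n x) $ i} \<noteq> b}"
          then show "x \<in> {x\<in>space MX. measure MW {w\<in>space MW.
              boot_t_stat MW W c th thb n (obs X n x) (wvec W n w) \<le> r n (obs X n x)} \<noteq> b} \<union> {x\<in>space MX. V n x \<le> 0}"
            using eq[of n x] by (cases "0 < V n x") auto
        qed
        show "cdf (distr ?\<mu> borel (\<lambda>z. z $ i)) q = b" using q by (simp add: \<nu>_def)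
        show "cdf (distr ?\<mu> borel (\<lambda>z. z $ i)) x < cdf (distr ?\<mu> borel (\<lambda>z. z $ i)) y" if "x < y" for x y
          using nu(3)[OF that] by (simp add: \<nu>_def)
      qed auto
      \<comment> \<open>Slutsky for constant limits: the ratio of the two standard deviation
        estimates tends to 1, so the root of \<open>Sh\<close> may replace that of the bootstrap
        variance; v > 0 gives continuity of the quotient.\<close>
      from conv_in_prob_Pair[OF conv_in_prob_Pair[OF s V] this]
      have "conv_in_prob MX (\<lambda>n x. case ((s n x, V n x), sqrt (V n x) * r n (obs X n x) $ i) of
          ((a, b), y) \<Rightarrow> sqrt a / sqrt b * y) (case ((v, v), q) of ((a, b), y) \<Rightarrow> sqrt a / sqrt b * y)"
        by (rule conv_in_prob_isCont) (use \<open>0 < v\<close> in \<open>auto simp: case_prod_beta intro!: continuous_intros\<close>)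
      then have "conv_in_prob MX (\<lambda>n x. sqrt (s n x) / sqrt (V n x) * (sqrt (V n x) * r n (obs X n x) $ i)) q"
        using \<open>0 < v\<close> by simp
      then show ?thesis
      proof (rule conv_in_prob_cong)
        show "(\<lambda>n. outer_measure_of MX {x\<in>space MX. sqrt (s n x) / sqrt (V n x) * (sqrt (V n x) * r n (obs X n x) $ i)
            \<noteq> matrix_sqrt (Sh n (obs X n x)) $ i $ i * r n (obs X n x) $ i}) \<longlonglongrightarrow> 0"
        proof (rule outer_measure_null_Un[OF nonpos[OF s] nonpos[OF V]], intro always_eventually allI subsetI, rule ccontr)
          fix n x assume *: "x \<in> {x\<in>space MX. sqrt (s n x) / sqrt (V n x) * (sqrt (V n x) * r n (obs X n x) $ i)
            \<noteq> matrix_sqrt (Sh n (obs X n x)) $ i $ i * r n (obs X n x) $ i}"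
            and "x \<notin> {x\<in>space MX. s n x \<le> 0} \<union> {x\<in>space MX. V n x \<le> 0}"
          then have "0 < s n x" "0 < V n x" by auto
          then show False using * by (simp add: matrix_sqrt_one_dim[OF U] dim1(2) s_def)
        qed
      qed
    qed
    obtain a where a: "cdf \<nu> a = \<alpha> / 2" using nu.cdf_quantile[OF nu(2), of "\<alpha> / 2"] \<alpha> by auto
    obtain b where b: "cdf \<nu> b = 1 - \<alpha> / 2" using nu.cdf_quantile[OF nu(2), of "1 - \<alpha> / 2"] \<alpha> by auto
    have "a < b"
    proof (rule ccontr)
      assume "\<not> a < b"
      then have "cdf \<nu> b \<le> cdf \<nu> a" by (intro nu.cdf_nondecreasing) simp
      then show False using a b \<alpha> by simp
    qed
    \<comment> \<open>In these terms membership of \<open>\<theta>0\<close> in the interval reads L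
      \<le> S \<le> R; the lower quantile bounds S from below because S is the estimator minus
      \<open>\<theta>0\<close>.\<close>
    define S where "S n x = sqrt (real n) * (th n (obs X n x) - \<theta>0) $ i" for n x
    define L where "L n x = matrix_sqrt (Sh n (obs X n x)) $ i $ i * lo n (obs X n x) $ i" for n x
    define R where "R n x = matrix_sqrt (Sh n (obs X n x)) $ i $ i * up n (obs X n x) $ i" for n x
    have sh[measurable]: "(\<lambda>x. matrix_sqrt (Sh n (obs X n x)) $ i $ i) \<in> borel_measurable MX" for n
      using measurable_compose[OF measurable_compose[OF obs_measurable[OF MX iid] Sh_meas] matrix_sqrt_measurable_one_dim[OF U]] .
    have [measurable]: "(\<lambda>x. lo n (obs X n x)) \<in> borel_measurable MX" "(\<lambda>x. up n (obs X n x)) \<in> borel_measurable MX" for n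
      using measurable_compose[OF obs_measurable[OF MX iid] lo_meas] measurable_compose[OF obs_measurable[OF MX iid] up_meas] .
    have meas[measurable]: "S n \<in> borel_measurable MX" "L n \<in> borel_measurable MX" "R n \<in> borel_measurable MX" for n
      unfolding S_def[abs_def] L_def[abs_def] R_def[abs_def] by measurable
    have "weak_conv_m (\<lambda>n. distr MX borel (S n)) \<nu>"
    proof (rule integral_bdd_continuous_conv_imp_weak_conv)
      fix f :: "real \<Rightarrow> real" assume f: "\<And>x. isCont f x" "\<And>x. \<bar>f x\<bar> \<le> 1"
      have cont: "continuous_on UNIV f" using f(1) by (simp add: continuous_at_imp_continuous_on)
      then have [measurable]: "f \<in> borel_measurable borel" by (rule borel_measurable_continuous_onI)
      have "continuous_on UNIV (\<lambda>y::real^'d. f (y $ i))"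
        by (rule continuous_on_compose2[OF cont]) (auto intro: continuous_intros)
      moreover have "bounded (range (\<lambda>y::real^'d. f (y $ i)))"
        using f(2) by (intro boundedI[of _ 1]) auto
      ultimately have "(\<lambda>n. \<integral>x. f ((sqrt (real n) *\<^sub>R (th n (obs X n x) - \<theta>0)) $ i) \<partial>MX) \<longlonglongrightarrow> (\<integral>y. f (y $ i) \<partial>?\<mu>)"
        using weak unfolding conv_in_distr_def by blast
      then show "(\<lambda>n. integral\<^sup>L (distr MX borel (S n)) f) \<longlonglongrightarrow> integral\<^sup>L \<nu> f"
        unfolding \<nu>_def by (simp add: integral_distr S_def)
    qed (simp_all add: X.real_distribution_distr nu(1))
    from random_interval_coverage[OF MX meas(1-3) this nu(2) quantile[OF lo a, folded L_def[abs_def]]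
        quantile[OF up b, folded R_def[abs_def]] \<open>a < b\<close>]
    have lim: "(\<lambda>n. measure MX {x\<in>space MX. L n x \<le> S n x \<and> S n x \<le> R n x}) \<longlonglongrightarrow> 1 - \<alpha>"
      using a b by simp
    show ?thesis
    proof (rule Lim_transform_eventually[OF lim])
      show "\<forall>\<^sub>F n in sequentially. measure MX {x\<in>space MX. L n x \<le> S n x \<and> S n x \<le> R n x} =
          measure (MX \<Otimes>\<^sub>M MW) {(x, w). x \<in> space MX \<and> w \<in> space MW \<and> \<theta>0 \<in> BC_t th Sh lo up n (obs X n x)}"
        \<comment> \<open>For n = 0 the scaling degenerates. For n \<ge> 1 the coverage event is a
          cylinder over the data, so its joint probability is its probability under
          \<open>MX\<close>.\<close>
        using eventually_ge_at_top[of "1::nat"]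
      proof eventually_elim
        case (elim n)
        then have "0 < sqrt (real n)" by simp
        then have "\<theta>0 \<in> BC_t th Sh lo up n (obs X n x) \<longleftrightarrow> L n x \<le> S n x \<and> S n x \<le> R n x" for x
          by (auto simp: BC_t_def dim1(3,5) L_def S_def R_def field_simps)
        then have "{(x, w). x \<in> space MX \<and> w \<in> space MW \<and> \<theta>0 \<in> BC_t th Sh lo up n (obs X n x)}
            = {x\<in>space MX. L n x \<le> S n x \<and> S n x \<le> R n x} \<times> space MW" by auto
        then show ?case
          by (simp add: measure_def W.emeasure_pair_measure_Times W.emeasure_space_1)
      qed
    qed
  qed
  with conv show ?thesis by blast
qed

end
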